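(* Let $\epsilon>0$ and $0<\delta<1$. Under the Standing Assumption (see context), with probability at least $1-\delta$, the algorithm BOUNDS$(A,B,\xi,a,b,d,\phi,\delta)$ described in the context computes lower and upper bounds $l$ and $u$ for (the optimal value of) problem (GTRS) satisfying $$u-l\le O\left(\frac{\phi^3}{\tilde\xi^2}\right),$$ and the total runtime is $$O\left(\frac{N\sqrt\phi}{\sqrt\xi}\log\left(\frac n\delta\log\frac1\xi\right)\log\frac1\xi\right).$$
   Context: Problem (GTRS): minimize $f(x)=x^TAx+2a^Tx$ over $x\in\mathbb R^n$ subject to $h(x)=x^TBx+2b^Tx+d\le0$, where $A,B$ are real symmetric $n\times n$ matrices (not necessarily positive semidefinite), $a,b\in\mathbb R^n$, $d\in\mathbb R$. $N$ is the total number of nonzero entries of $A$ and $B$, with $N\ge n$ assumed without loss of generality. $\|\cdot\|_2$ is the operator norm, $\|\cdot\|$ the Euclidean norm, $\lambda_{\min}$ the smallest eigenvalue. Standing Assumption: $\rho_A,\rho_B$ are given with $\|A\|_2\le\rho_A\le3\|A\|_2$ and $\|B\|_2\le\rho_B\le3\|B\|_2$; $B$ has at least one negative eigenvalue, with $\lambda_{\min}(B)\le-\xi<0$ for some $\xi>0$; for the same $\xi$ there exists $\mu\in(0,1]$ with $\mu A+(1-\mu)B\succeq\xi I$. Notation: $\tilde\xi=\min\{\xi,1\}$, $\phi=\rho_A+\rho_B+\|a\|+\|b\|+|d|+1$. Oracle APPROXMINEV$(C,\eta,\theta)$: for symmetric $C\in\mathbb R^{n\times n}$ with $\|C\|_2\le\rho$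 and $N$ nonzero entries and $\eta,\theta>0$, returns $(\lambda,x)$ with $x$ a unit vector and $\lambda=x^TCx$ such that, with probability at least $1-\theta$, $x^TCx\le\lambda_{\min}(C)+\eta$; time $O(\frac{N\sqrt\rho}{\sqrt\eta}\log\frac n\theta)$. PSDPENCIL$(A,B,\xi,\phi,\theta)$: set $T=\log_2(8\phi/\xi)$, $\mu_1=0$, $\mu_2=1$. For $i=1,\dots,T$: set $\mu=(\mu_1+\mu_2)/2$; call $(\lambda,x)\leftarrow$ APPROXMINEV$(\mu A+(1-\mu)B,\xi/4,\theta/T)$; if $\lambda\ge3\xi/4$ return $(\mu,\lambda,x)$; else if $x^TAx>x^TBx$ set $\mu_1\leftarrow\mu$; else set $\mu_2\leftarrow\mu$. If the loop ends, report that the assumption fails. BOUNDS$(A,B,\xi,a,b,d,\phi,\delta)$: call $(\mu_0,\lambda,x)\leftarrow$ PSDPENCIL$(A,B,\xi,\phi,\delta/2)$; put $\bar\lambda=\lambda-\xi/4$, $\nu_0=(1-\mu_0)/\mu_0$, $p=a+\nu_0b$; set the lower bound $l=d\nu_0-\mu_0\|p\|^2/\bar\lambda$; call $(\varpi,y)\leftarrow$ APPROXMINEV$(B,\xi/2,\delta/2)$; find a root $\alpha$ of $\varpi\alpha^2+2b^Ty\,\alpha+d=0$; set the upper bound $u=f(\alpha y)$; return $(\mu_0,\lambda,l,u)$.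
   Formalization: The runtime bound is claimed only for ξ ≤ 1/4 and log φ ≤ c·log(1/ξ), with a constant depending on c (any c > 0), as it fails uniformly in φ and for ξ near or above 1; when the quadratic for α has no real root, α = 0 is used; T is rounded up to an integer. *)

theory Defs
  imports "HOL-Probability.Probability" "Jordan_Normal_Form.Char_Poly"
begin

unbundle no inner_syntax
unbundle no vec_syntax
hide_type (open) Finite_Cartesian_Product.vec

definition vnorm :: "real vec \<Rightarrow> real" where
  "vnorm x = sqrt (x \<bullet> x)"

definition op_norm :: "real mat \<Rightarrow> real" where
  "op_norm C = (SUP x \<in> {x \<in> carrier_vec (dim_col C). vnorm x \<le> 1}. vnorm (C *\<^sub>v x))"

definition sym_mat :: "nat \<Rightarrow> real mat \<Rightarrow> bool" where
  "sym_mat n C \<longleftrightarrow> C \<in> carrier_mat n n \<and> transpose_mat C = C"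

definition psd :: "nat \<Rightarrow> real mat \<Rightarrow> bool" where
  "psd n C \<longleftrightarrow> (\<forall>x \<in> carrier_vec n. 0 \<le> x \<bullet> (C *\<^sub>v x))"

text \<open>Only used for symmetric matrices of positive dimension, whose set of real eigenvalues is
  finite and nonempty.\<close>
definition lambda_min :: "real mat \<Rightarrow> real" where
  "lambda_min C = Min {k. eigenvalue C k}"

definition nnz :: "real mat \<Rightarrow> nat" where
  "nnz C = card {(i, j). i < dim_row C \<and> j < dim_col C \<and> C $$ (i, j) \<noteq> 0}"

definition pencil :: "real mat \<Rightarrow> real mat \<Rightarrow> real \<Rightarrow> real mat" where
  "pencil A B \<mu> = \<mu> \<cdot>\<^sub>m A + (1 - \<mu>) \<cdot>\<^sub>m B"

definition obj_f :: "real mat \<Rightarrow> real vec \<Rightarrow> real vec \<Rightarrow> real" where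
  "obj_f A a x = x \<bullet> (A *\<^sub>v x) + 2 * (a \<bullet> x)"

definition con_h :: "real mat \<Rightarrow> real vec \<Rightarrow> real \<Rightarrow> real vec \<Rightarrow> real" where
  "con_h B b d x = x \<bullet> (B *\<^sub>v x) + 2 * (b \<bullet> x) + d"

text \<open>The infimum is taken in the extended reals, so that an infeasible or an unbounded problem
  would get the value \<open>\<infinity>\<close> or \<open>-\<infinity>\<close>.\<close>
definition gtrs_val ::
  "nat \<Rightarrow> real mat \<Rightarrow> real mat \<Rightarrow> real vec \<Rightarrow> real vec \<Rightarrow> real \<Rightarrow> ereal" where
  "gtrs_val n A B a b d =
     (INF x \<in> {x \<in> carrier_vec n. con_h B b d x \<le> 0}. ereal (obj_f A a x))"

definition gtrs_data :: "nat \<Rightarrow> real mat \<Rightarrow> real mat \<Rightarrow> real vec \<Rightarrow> real vec \<Rightarrow> bool" where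
  "gtrs_data n A B a b \<longleftrightarrow> 0 < n \<and> sym_mat n A \<and> sym_mat n B \<and>
     a \<in> carrier_vec n \<and> b \<in> carrier_vec n \<and> n \<le> nnz A + nnz B"

definition standing_assumption ::
  "nat \<Rightarrow> real mat \<Rightarrow> real mat \<Rightarrow> real \<Rightarrow> real \<Rightarrow> real \<Rightarrow> bool" where
  "standing_assumption n A B \<rho>\<^sub>A \<rho>\<^sub>B \<xi> \<longleftrightarrow>
     op_norm A \<le> \<rho>\<^sub>A \<and> \<rho>\<^sub>A \<le> 3 * op_norm A \<and>
     op_norm B \<le> \<rho>\<^sub>B \<and> \<rho>\<^sub>B \<le> 3 * op_norm B \<and>
     0 < \<xi> \<and> (\<exists>k. eigenvalue B k \<and> k < 0) \<and> lambda_min B \<le> - \<xi> \<and>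
     (\<exists>\<mu>. 0 < \<mu> \<and> \<mu> \<le> 1 \<and> psd n (pencil A B \<mu> - \<xi> \<cdot>\<^sub>m 1\<^sub>m n))"

definition phi :: "real \<Rightarrow> real \<Rightarrow> real vec \<Rightarrow> real vec \<Rightarrow> real \<Rightarrow> real" where
  "phi \<rho>\<^sub>A \<rho>\<^sub>B a b d = \<rho>\<^sub>A + \<rho>\<^sub>B + vnorm a + vnorm b + \<bar>d\<bar> + 1"

text \<open>\<open>P\<close> need not describe a measurable set.\<close>
definition holds_with_prob :: "'w measure \<Rightarrow> real \<Rightarrow> ('w \<Rightarrow> bool) \<Rightarrow> bool" where
  "holds_with_prob M p P \<longleftrightarrow> (\<exists>E \<in> sets M. (\<forall>\<omega> \<in> E. P \<omega>) \<and> p \<le> measure M E)"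

text \<open>A call \<open>orc s C \<rho> \<eta> \<theta>\<close> with random seed \<open>s\<close> returns \<open>(\<lambda>, x, t)\<close>, where \<open>t\<close> is the number of
  elementary operations spent.  The norm bound \<open>\<rho>\<close>, which the runtime of the solver depends on, is
  passed explicitly.\<close>
type_synonym 'r ev_solver =
  "'r \<Rightarrow> real mat \<Rightarrow> real \<Rightarrow> real \<Rightarrow> real \<Rightarrow> real \<times> real vec \<times> nat"

text \<open>\<open>R\<close> is the distribution of the seed of a single call and \<open>\<kappa>\<close> the constant hidden in the
  runtime bound of the solver.  The runtime bound is only required for \<open>\<eta> \<le> \<rho>\<close> and \<open>\<theta> \<le> 1/2\<close>: outside
  of that range the expression \<open>N \<surd>\<rho> / \<surd>\<eta> log (n/\<theta>)\<close> may be arbitrarily small or negative, and no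
  algorithm could meet it.\<close>
definition approx_min_ev :: "'r measure \<Rightarrow> 'r ev_solver \<Rightarrow> real \<Rightarrow> bool" where
  "approx_min_ev R orc \<kappa> \<longleftrightarrow> prob_space R \<and>
     (\<forall>n C \<rho> \<eta> \<theta>. 0 < n \<and> sym_mat n C \<and> op_norm C \<le> \<rho> \<and> 0 < \<eta> \<and> 0 < \<theta> \<longrightarrow>
        (\<forall>s \<in> space R. case orc s C \<rho> \<eta> \<theta> of (lam, x, t) \<Rightarrow>
            x \<in> carrier_vec n \<and> vnorm x = 1 \<and> lam = x \<bullet> (C *\<^sub>v x)) \<and>
        (\<forall>i < n. (\<lambda>s. case orc s C \<rho> \<eta> \<theta> of (lam, x, t) \<Rightarrow> x $ i) \<in> borel_measurable R) \<and>
        holds_with_prob R (1 - \<theta>)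
          (\<lambda>s. case orc s C \<rho> \<eta> \<theta> of (lam, x, t) \<Rightarrow> x \<bullet> (C *\<^sub>v x) \<le> lambda_min C + \<eta>) \<and>
        (\<eta> \<le> \<rho> \<and> \<theta> \<le> 1/2 \<longrightarrow>
          (\<forall>s \<in> space R. \<forall>N. n \<le> N \<and> nnz C \<le> N \<longrightarrow>
             (case orc s C \<rho> \<eta> \<theta> of (lam, x, t) \<Rightarrow>
                real t \<le> \<kappa> * (real N * sqrt \<rho> / sqrt \<eta> * ln (real n / \<theta>))))))"

text \<open>Each algorithm returns its result together with its running time.  A seed sequence \<open>\<omega>\<close>
  provides the randomness; no two solver calls of a run use the same entry of it.  Besides the solver
  calls, a group of \<open>O(1)\<close> sparse vector and matrix operations and scalar operations is charged
  \<open>w * N\<close> elementary operations, where \<open>w\<close> is an arbitrary constant and \<open>N\<close> the number of nonzero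
  entries of \<open>A\<close> and \<open>B\<close>.\<close>

text \<open>\<open>psd_loop \<dots> k i \<mu>1 \<mu>2\<close> executes the last \<open>k\<close> iterations; \<open>\<theta>'\<close> is the failure probability
  of a single solver call.  The result \<open>None\<close> reports that the assumption fails.\<close>
fun psd_loop ::
  "'r ev_solver \<Rightarrow> nat \<Rightarrow> real mat \<Rightarrow> real mat \<Rightarrow> real \<Rightarrow> real \<Rightarrow> real \<Rightarrow> (nat \<Rightarrow> 'r) \<Rightarrow>
   nat \<Rightarrow> nat \<Rightarrow> real \<Rightarrow> real \<Rightarrow> (real \<times> real \<times> real vec) option \<times> nat" where
  "psd_loop orc w A B \<xi> \<phi> \<theta>' \<omega> 0 i \<mu>1 \<mu>2 = (None, 0)"
| "psd_loop orc w A B \<xi> \<phi> \<theta>' \<omega> (Suc k) i \<mu>1 \<mu>2 =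
    (let \<mu> = (\<mu>1 + \<mu>2) / 2;
         (lam, x, t) = orc (\<omega> i) (pencil A B \<mu>) \<phi> (\<xi> / 4) \<theta>';
         t' = t + w * (nnz A + nnz B)
     in if lam \<ge> 3 * \<xi> / 4 then (Some (\<mu>, lam, x), t')
        else let (r, t'') =
               (if x \<bullet> (A *\<^sub>v x) > x \<bullet> (B *\<^sub>v x)
                then psd_loop orc w A B \<xi> \<phi> \<theta>' \<omega> k (Suc i) \<mu> \<mu>2
                else psd_loop orc w A B \<xi> \<phi> \<theta>' \<omega> k (Suc i) \<mu>1 \<mu>)
             in (r, t' + t''))"

text \<open>The number of iterations is rounded up to an integer.\<close>
definition num_iter :: "real \<Rightarrow> real \<Rightarrow> nat" where
  "num_iter \<xi> \<phi> = nat \<lceil>log 2 (8 * \<phi> / \<xi>)\<rceil>"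

definition psd_pencil ::
  "'r ev_solver \<Rightarrow> nat \<Rightarrow> real mat \<Rightarrow> real mat \<Rightarrow> real \<Rightarrow> real \<Rightarrow> real \<Rightarrow> (nat \<Rightarrow> 'r) \<Rightarrow>
   (real \<times> real \<times> real vec) option \<times> nat" where
  "psd_pencil orc w A B \<xi> \<phi> \<theta> \<omega> =
    (let T = num_iter \<xi> \<phi> in psd_loop orc w A B \<xi> \<phi> (\<theta> / real T) \<omega> T 0 0 1)"

text \<open>\<open>rt p q r\<close> finds a root of \<open>p \<alpha>\<^sup>2 + 2 q \<alpha> + r\<close>, which root is left open.  In \<open>bounds\<close> below a
  real root need not exist: for \<open>p < 0\<close> and \<open>r < 0\<close> the quadratic may be negative on the whole line
  (all multiples of \<open>y\<close> are then strictly feasible), in which case \<open>\<alpha> = 0\<close> is taken.\<close>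
definition root_finder :: "(real \<Rightarrow> real \<Rightarrow> real \<Rightarrow> real) \<Rightarrow> bool" where
  "root_finder rt \<longleftrightarrow>
     (\<forall>p q r. if \<exists>\<alpha>. p * \<alpha>\<^sup>2 + 2 * q * \<alpha> + r = 0
              then p * (rt p q r)\<^sup>2 + 2 * q * rt p q r + r = 0
              else rt p q r = 0)"

text \<open>The solver call for \<open>B\<close> uses a seed that no iteration of the bisection loop uses.\<close>
definition bounds ::
  "'r ev_solver \<Rightarrow> (real \<Rightarrow> real \<Rightarrow> real \<Rightarrow> real) \<Rightarrow> nat \<Rightarrow> real mat \<Rightarrow> real mat \<Rightarrow> real \<Rightarrow>
   real vec \<Rightarrow> real vec \<Rightarrow> real \<Rightarrow> real \<Rightarrow> real \<Rightarrow> (nat \<Rightarrow> 'r) \<Rightarrow>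
   (real \<times> real \<times> real \<times> real) option \<times> nat" where
  "bounds orc rt w A B \<xi> a b d \<phi> \<delta> \<omega> =
    (case psd_pencil orc w A B \<xi> \<phi> (\<delta> / 2) \<omega> of
       (None, t1) \<Rightarrow> (None, t1)
     | (Some (\<mu>0, lam, x), t1) \<Rightarrow>
         (let lam' = lam - \<xi> / 4;
              \<nu>0 = (1 - \<mu>0) / \<mu>0;
              p = a + \<nu>0 \<cdot>\<^sub>v b;
              l = d * \<nu>0 - \<mu>0 * (vnorm p)\<^sup>2 / lam';
              (ev, y, t2) = orc (\<omega> (num_iter \<xi> \<phi>)) B \<phi> (\<xi> / 2) (\<delta> / 2);
              \<alpha> = rt ev (b \<bullet> y) d;
              u = obj_f A a (\<alpha> \<cdot>\<^sub>v y)
          in (Some (\<mu>0, lam, l, u), t1 + t2 + w * (nnz A + nnz B))))"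

end

theory Submission
  imports Defs
begin

text \<open>The lower bound \<open>l\<close> estimates a Lagrangian dual value from below. If the pencil \<open>\<mu> A + (1 - \<mu>) B\<close> is positive definite at
  some \<open>\<mu>\<close> in \<open>(0, 1]\<close>, then \<open>f + \<nu> h\<close> with \<open>\<nu> = (1 - \<mu>) / \<mu>\<close> is strictly convex, it lies below \<open>f\<close> on the
  feasible set, and its minimum can be estimated explicitly (\<open>gtrs_lower_bound\<close>). The upper bound \<open>u\<close> is
  the value of \<open>f\<close> at a feasible multiple of an approximate eigenvector of \<open>B\<close> for its smallest eigenvalue, which is negative:
  along this direction \<open>h\<close> is a concave quadratic, so it has a root of size \<open>O(\<phi> / \<xi>)\<close> or is negative
  throughout (\<open>root_finder_feasible\<close>, \<open>root_finder_abs_le\<close>).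

  The gap is controlled by two facts. The point \<open>\<mu>\<close> is not too small, because at \<open>\<mu> = 0\<close> the pencil is
  \<open>B\<close>, which has a negative eigenvalue, and in each unit direction the term \<open>\<mu> A\<close> can only make up for
  \<open>\<mu> \<phi>\<close>; hence \<open>1 / \<mu> \<le> 2 \<phi> / \<xi>\<close>. And the curvature of \<open>f + \<nu> h\<close> is at least \<open>\<xi> / (2 \<mu>)\<close>. Both \<open>u\<close> and \<open>- l\<close> are then at
  most of the order \<open>\<phi> ^ 3 / (min \<xi> 1)\<^sup>2\<close> (\<open>gap_bound\<close>).

  The bisection finds such a \<open>\<mu>\<close> because a vector at which the pencil is not positive enough is a
  cutting plane: its quadratic form is affine in the parameter and the sign of the slope tells on which side
  a definite point lies. Thus the search always terminates with an answer (\<open>psd_loop_result\<close>), and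
  the randomness matters only for the answer being correct. The matrices of
  the calls depend on the seeds of earlier calls, so the failure probabilities are added up by a union
  bound for adaptively chosen experiments (\<open>adaptive_union_bound\<close>), proved by Fubini's theorem on the
  product space of seeds.

  The smallest eigenvalue enters through its variational characterization
  (\<open>lambda_min_le_rayleigh\<close>, \<open>lambda_min_rayleigh_attained\<close>). The running time is the number of
  iterations, which is \<open>O(ln (1 / \<xi>))\<close> when \<open>ln \<phi>\<close> is, times the cost of one call (\<open>bounds_time\<close>,
  \<open>runtime_bound\<close>).\<close>

section \<open>Euclidean norm and operator norm\<close>

lemma vnorm_L2_set: "vnorm x = L2_set (\<lambda>i. x $ i) {0..<dim_vec x}"
  by (simp add: vnorm_def L2_set_def scalar_prod_def power2_eq_square)

lemma vnorm_nonneg [simp]: "0 \<le> vnorm x"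
  by (simp add: vnorm_L2_set)

lemma scalar_self_nonneg [simp]: "0 \<le> x \<bullet> (x :: real vec)"
  by (simp add: scalar_prod_def sum_nonneg)

lemma scalar_self_eq_vnorm_sq: "x \<bullet> x = (vnorm x)\<^sup>2"
  by (simp add: vnorm_def)

lemma vnorm_zero [simp]: "vnorm (0\<^sub>v n) = 0"
  by (simp add: vnorm_def scalar_prod_def)

lemma vnorm_smult: "vnorm (k \<cdot>\<^sub>v x) = \<bar>k\<bar> * vnorm x"
  by (simp add: vnorm_def real_sqrt_mult)

lemma vnorm_eq_0_iff: "x \<in> carrier_vec n \<Longrightarrow> vnorm x = 0 \<longleftrightarrow> x = 0\<^sub>v n"
  by (auto simp: vnorm_L2_set L2_set_eq_0_iff)

lemma scalar_prod_le_vnorm: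
  assumes "x \<in> carrier_vec n" "y \<in> carrier_vec n"
  shows "\<bar>x \<bullet> y\<bar> \<le> vnorm x * vnorm y"
proof -
  have "\<bar>x \<bullet> y\<bar> \<le> (\<Sum>i = 0..<n. \<bar>x $ i\<bar> * \<bar>y $ i\<bar>)"
    using assms unfolding scalar_prod_def by (auto intro!: order_trans[OF sum_abs] simp: abs_mult)
  also have "\<dots> \<le> vnorm x * vnorm y"
    using L2_set_mult_ineq assms by (auto simp: vnorm_L2_set)
  finally show ?thesis .
qed

lemma vnorm_triangle:
  assumes "x \<in> carrier_vec n" "y \<in> carrier_vec n"
  shows "vnorm (x + y) \<le> vnorm x + vnorm y"
proof -
  have "vnorm (x + y) = L2_set (\<lambda>i. x $ i + y $ i) {0..<n}"
    using assms unfolding vnorm_L2_set by (intro L2_set_cong) auto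
  then show ?thesis
    using L2_set_triangle_ineq[of "\<lambda>i. x $ i" "\<lambda>i. y $ i" "{0..<n}"] assms
    by (simp add: vnorm_L2_set)
qed

lemma mult_mat_vec_bounded:
  assumes "C \<in> carrier_mat m n"
  obtains K where "0 < K" "\<And>x. x \<in> carrier_vec n \<Longrightarrow> vnorm (C *\<^sub>v x) \<le> K * vnorm x"
proof
  define K where "K = (\<Sum>i = 0..<m. vnorm (row C i)) + 1"
  show "0 < K"
    by (simp add: K_def add_nonneg_pos sum_nonneg)
  fix x :: "real vec" assume x: "x \<in> carrier_vec n"
  have "vnorm (C *\<^sub>v x) \<le> (\<Sum>i = 0..<m. \<bar>(C *\<^sub>v x) $ i\<bar>)"
    using L2_set_le_sum_abs[of "($) (C *\<^sub>v x)" "{0..<m}"] assms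
    by (simp add: vnorm_L2_set)
  also have "\<dots> \<le> (\<Sum>i = 0..<m. vnorm (row C i) * vnorm x)"
    using assms x by (intro sum_mono) (auto intro!: scalar_prod_le_vnorm[of _ n])
  also have "\<dots> \<le> K * vnorm x"
    by (simp add: K_def algebra_simps flip: sum_distrib_left)
  finally show "vnorm (C *\<^sub>v x) \<le> K * vnorm x" .
qed

text \<open>Since \<^const>\<open>op_norm\<close> is a supremum of reals, it says something only when the supremum is
  taken over a bounded set; this is what the crude row-wise bound above provides.\<close>
lemma vnorm_mult_mat_vec_le:
  assumes C: "C \<in> carrier_mat m n" and x: "x \<in> carrier_vec n"
  shows "vnorm (C *\<^sub>v x) \<le> op_norm C * vnorm x"
proof (cases "x = 0\<^sub>v n")
  case True
  then have "C *\<^sub>v x = 0\<^sub>v m"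
    using C by (intro eq_vecI) auto
  then show ?thesis using True by simp
next
  case False
  define r where "r = vnorm x"
  have r: "0 < r"
    using False vnorm_eq_0_iff[OF x] vnorm_nonneg[of x] unfolding r_def by linarith
  obtain K where K: "0 < K" "\<And>x. x \<in> carrier_vec n \<Longrightarrow> vnorm (C *\<^sub>v x) \<le> K * vnorm x"
    using mult_mat_vec_bounded[OF C] by metis
  have "bdd_above ((\<lambda>x. vnorm (C *\<^sub>v x)) ` {x \<in> carrier_vec n. vnorm x \<le> 1})"
  proof (rule bdd_aboveI2)
    fix x assume "x \<in> {x \<in> carrier_vec n. vnorm x \<le> 1}"
    then have "vnorm (C *\<^sub>v x) \<le> K * vnorm x" "K * vnorm x \<le> K"
      using K by auto
    then show "vnorm (C *\<^sub>v x) \<le> K" by linarith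
  qed
  then have "vnorm (C *\<^sub>v ((1 / r) \<cdot>\<^sub>v x)) \<le> op_norm C"
    using C x r unfolding op_norm_def
    by (intro cSUP_upper2[where x = "(1 / r) \<cdot>\<^sub>v x"]) (auto simp: vnorm_smult r_def)
  then show ?thesis
    using r mult_mat_vec[OF C x, of "1 / r"] by (simp add: vnorm_smult field_simps flip: r_def)
qed

lemma op_norm_leI:
  assumes "C \<in> carrier_mat m n" "\<And>x. x \<in> carrier_vec n \<Longrightarrow> vnorm x \<le> 1 \<Longrightarrow> vnorm (C *\<^sub>v x) \<le> K"
  shows "op_norm C \<le> K"
  unfolding op_norm_def using assms
  by (intro cSUP_least) (auto intro!: exI[of _ "0\<^sub>v n"])

lemma op_norm_nonneg:
  assumes "C \<in> carrier_mat m n" "0 < n"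
  shows "0 \<le> op_norm C"
proof -
  have "vnorm (unit_vec n 0) = 1"
    using assms by (simp add: vnorm_def)
  then show ?thesis
    using vnorm_mult_mat_vec_le[OF assms(1), of "unit_vec n 0"] vnorm_nonneg[of "C *\<^sub>v unit_vec n 0"] 
    by (simp del: vnorm_nonneg)
qed

lemma quad_form_le_op_norm:
  assumes "C \<in> carrier_mat n n" "x \<in> carrier_vec n"
  shows "\<bar>x \<bullet> (C *\<^sub>v x)\<bar> \<le> op_norm C * (vnorm x)\<^sup>2"
proof -
  have "\<bar>x \<bullet> (C *\<^sub>v x)\<bar> \<le> vnorm x * vnorm (C *\<^sub>v x)"
    using assms by (intro scalar_prod_le_vnorm) auto
  also have "\<dots> \<le> vnorm x * (op_norm C * vnorm x)"
    using assms by (intro mult_left_mono vnorm_mult_mat_vec_le) auto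
  finally show ?thesis by (simp add: power2_eq_square algebra_simps)
qed

section \<open>The smallest eigenvalue of a symmetric matrix\<close>

lemma sym_mat_scalar_swap:
  assumes "sym_mat n C" "x \<in> carrier_vec n" "y \<in> carrier_vec n"
  shows "(C *\<^sub>v x) \<bullet> y = x \<bullet> (C *\<^sub>v y)"
  using transpose_vec_mult_scalar[of C n n y x] assms by (simp add: sym_mat_def)

text \<open>A semidefinite quadratic form that is small at \<open>x\<close> forces \<open>M x\<close> to be small: the form is nonnegative
  at \<open>x - M x / K\<close>, and expanding it there gives the estimate.\<close>
lemma psd_vnorm_sq_le:
  assumes M: "sym_mat n M" and psd: "psd n M" and x: "x \<in> carrier_vec n" and K: "0 < K"
    and bound: "\<And>v. v \<in> carrier_vec n \<Longrightarrow> v \<bullet> (M *\<^sub>v v) \<le> K * (vnorm v)\<^sup>2"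
  shows "(vnorm (M *\<^sub>v x))\<^sup>2 \<le> K * (x \<bullet> (M *\<^sub>v x))"
proof -
  define y where "y = M *\<^sub>v x"
  have Mc: "M \<in> carrier_mat n n" and y: "y \<in> carrier_vec n"
    using M x by (auto simp: sym_mat_def y_def)
  have "0 \<le> (x + (- 1 / K) \<cdot>\<^sub>v y) \<bullet> (M *\<^sub>v (x + (- 1 / K) \<cdot>\<^sub>v y))"
    using psd x y by (auto simp: psd_def)
  also have "\<dots> = x \<bullet> y - 2 / K * (y \<bullet> y) + (1 / K)\<^sup>2 * (y \<bullet> (M *\<^sub>v y))"
    using x y Mc sym_mat_scalar_swap[OF M x y]
    by (simp add: mult_add_distrib_mat_vec[of _ n n] mult_mat_vec[of _ n n] scalar_prod_add_distrib[of _ n] 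
        add_scalar_prod_distrib[of _ n] y_def[symmetric] power2_eq_square diff_divide_distrib algebra_simps)
  also have "\<dots> \<le> x \<bullet> y - 2 / K * (y \<bullet> y) + (1 / K)\<^sup>2 * (K * (vnorm y)\<^sup>2)"
    by (intro add_left_mono mult_left_mono bound y) auto
  also have "\<dots> = x \<bullet> y - (vnorm y)\<^sup>2 / K"
    using K by (simp add: scalar_self_eq_vnorm_sq power2_eq_square field_simps)
  finally show ?thesis
    using K by (simp add: y_def field_simps)
qed

lemma finite_eigenvalues:
  assumes "C \<in> carrier_mat n n"
  shows "finite {k :: real. eigenvalue C k}"
proof -
  have "char_poly C \<noteq> 0"
    using degree_monic_char_poly[OF assms] by auto
  then show ?thesis
    using poly_roots_finite by (simp add: eigenvalue_root_char_poly[OF assms])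
qed

text \<open>The infimum \<open>m\<close> of the Rayleigh quotient is an eigenvalue. The matrix \<open>M = C - m I\<close> is semidefinite. If it were invertible, then \<open>x\<close> could be bounded by \<open>M x\<close>, and
  the preceding lemma would bound \<open>x \<bullet> M x\<close> away from \<open>0\<close> on the unit sphere, so that \<open>m\<close> could be
  increased.\<close>
lemma exists_eigenvalue_le_rayleigh:
  assumes C: "sym_mat n C" and n: "0 < n"
  obtains m where "eigenvalue C m" "\<And>x. x \<in> carrier_vec n \<Longrightarrow> m * (vnorm x)\<^sup>2 \<le> x \<bullet> (C *\<^sub>v x)"
proof -
  define S where "S = {x \<in> carrier_vec n. vnorm x = 1}"
  define m where "m = (INF x \<in> S. x \<bullet> (C *\<^sub>v x))"
  define M where "M = char_matrix C m"
  have Cc: "C \<in> carrier_mat n n"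
    using C by (simp add: sym_mat_def)
  have Mc: "M \<in> carrier_mat n n"
    using Cc by (simp add: M_def)
  have bdd: "bdd_below ((\<lambda>x. x \<bullet> (C *\<^sub>v x)) ` S)"
    using quad_form_le_op_norm[OF Cc] by (intro bdd_belowI2[of _ "- op_norm C"]) (force simp: S_def)
  have ray: "m * (vnorm x)\<^sup>2 \<le> x \<bullet> (C *\<^sub>v x)" if x: "x \<in> carrier_vec n" for x
  proof (cases "x = 0\<^sub>v n")
    case True
    then show ?thesis using Cc by simp
  next
    case False
    define r where "r = vnorm x"
    have r: "0 < r"
      using False vnorm_eq_0_iff[OF x] vnorm_nonneg[of x] unfolding r_def by linarith
    have "m \<le> ((1 / r) \<cdot>\<^sub>v x) \<bullet> (C *\<^sub>v ((1 / r) \<cdot>\<^sub>v x))"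
      unfolding m_def using x r by (intro cINF_lower bdd) (auto simp: S_def vnorm_smult r_def)
    also have "\<dots> = x \<bullet> (C *\<^sub>v x) / r\<^sup>2"
      using x Cc by (simp add: mult_mat_vec power2_eq_square)
    finally show ?thesis
      using r by (simp add: r_def[symmetric] field_simps)
  qed
  have Mq: "x \<bullet> (M *\<^sub>v x) = x \<bullet> (C *\<^sub>v x) - m * (vnorm x)\<^sup>2" if x: "x \<in> carrier_vec n" for x
  proof -
    have "M *\<^sub>v x = C *\<^sub>v x + (- m) \<cdot>\<^sub>v x"
      using Cc x unfolding M_def char_matrix_def
      by (subst add_mult_distrib_mat_vec[of _ n n]) (auto intro!: eq_vecI)
    then show ?thesis
      using Cc x by (simp add: scalar_prod_add_distrib[of _ n] scalar_self_eq_vnorm_sq)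
  qed
  have "eigenvalue C m"
  proof (rule ccontr)
    assume "\<not> eigenvalue C m"
    then have "det M \<noteq> 0"
      by (simp add: eigenvalue_det[OF Cc] M_def)
    then obtain W where W: "W \<in> carrier_mat n n" "W * M = 1\<^sub>m n"
      using det_non_zero_imp_unit[OF Mc, of undefined] 
      by (auto simp: Units_def ring_mat_simps)
    obtain K where K: "0 < K" "\<And>x. x \<in> carrier_vec n \<Longrightarrow> vnorm (M *\<^sub>v x) \<le> K * vnorm x"
      using mult_mat_vec_bounded[OF Mc] by metis
    obtain L where L: "0 < L" "\<And>x. x \<in> carrier_vec n \<Longrightarrow> vnorm (W *\<^sub>v x) \<le> L * vnorm x"
      using mult_mat_vec_bounded[OF W(1)] by metis
    have Ms: "sym_mat n M"
      using C unfolding M_def char_matrix_def sym_mat_def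
      by (auto intro!: eq_matI simp: transpose_add)
    have Mp: "psd n M"
      using ray Mq by (auto simp: psd_def)
    have bound: "v \<bullet> (M *\<^sub>v v) \<le> K * (vnorm v)\<^sup>2" if v: "v \<in> carrier_vec n" for v
    proof -
      have "v \<bullet> (M *\<^sub>v v) \<le> vnorm v * vnorm (M *\<^sub>v v)"
        using scalar_prod_le_vnorm[OF v, of "M *\<^sub>v v"] Mc v by auto
      also have "\<dots> \<le> vnorm v * (K * vnorm v)"
        using K(2)[OF v] by (intro mult_left_mono) auto
      finally show ?thesis by (simp add: power2_eq_square algebra_simps)
    qed
    have "m + 1 / (L\<^sup>2 * K) \<le> x \<bullet> (C *\<^sub>v x)" if "x \<in> S" for x
    proof -
      have x: "x \<in> carrier_vec n" and x1: "vnorm x = 1"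
        using that by (auto simp: S_def)
      have "x = W *\<^sub>v (M *\<^sub>v x)"
        using assoc_mult_mat_vec[OF W(1) Mc x] W(2) x by simp
      then have "1 \<le> L * vnorm (M *\<^sub>v x)"
        using L(2)[of "M *\<^sub>v x"] Mc x x1 by auto
      then have "1 \<le> (L * vnorm (M *\<^sub>v x))\<^sup>2"
        by simp
      also have "\<dots> \<le> L\<^sup>2 * (K * (x \<bullet> (M *\<^sub>v x)))"
        unfolding power_mult_distrib
        by (intro mult_left_mono psd_vnorm_sq_le[OF Ms Mp x K(1) bound]) auto
      finally show ?thesis
        using K(1) L(1) Mq[OF x] x1 by (simp add: field_simps)
    qed
    moreover have "S \<noteq> {}"
    proof -
      have "unit_vec n 0 \<in> S"
        using n by (simp add: S_def vnorm_def)
      then show ?thesis by blast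
    qed
    ultimately have "m + 1 / (L\<^sup>2 * K) \<le> m"
      by (subst (2) m_def) (rule cINF_greatest)
    moreover have "0 < 1 / (L\<^sup>2 * K)"
      using K(1) L(1) by simp
    ultimately show False by linarith
  qed
  then show ?thesis using ray that by blast
qed

lemma lambda_min_le_rayleigh:
  assumes "sym_mat n C" "0 < n" "x \<in> carrier_vec n"
  shows "lambda_min C * (vnorm x)\<^sup>2 \<le> x \<bullet> (C *\<^sub>v x)"
proof -
  obtain m where m: "eigenvalue C m" "m * (vnorm x)\<^sup>2 \<le> x \<bullet> (C *\<^sub>v x)"
    using exists_eigenvalue_le_rayleigh[OF assms(1,2)] assms(3) by metis
  have "lambda_min C \<le> m"
    using m(1) finite_eigenvalues[of C n] assms(1) by (auto simp: lambda_min_def sym_mat_def intro: Min_le)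
  then show ?thesis
    using m(2) mult_right_mono[of "lambda_min C" m "(vnorm x)\<^sup>2"] by simp
qed

lemma lambda_min_rayleigh_attained:
  assumes C: "sym_mat n C" and n: "0 < n"
  obtains v where "v \<in> carrier_vec n" "vnorm v = 1" "v \<bullet> (C *\<^sub>v v) = lambda_min C"
proof -
  have Cc: "C \<in> carrier_mat n n"
    using C by (simp add: sym_mat_def)
  obtain m where "eigenvalue C m"
    using exists_eigenvalue_le_rayleigh[OF C n] by metis
  then have "eigenvalue C (lambda_min C)"
    using Min_in[OF finite_eigenvalues[OF Cc]] by (auto simp: lambda_min_def)
  then obtain v where v: "v \<in> carrier_vec n" "v \<noteq> 0\<^sub>v n" "C *\<^sub>v v = lambda_min C \<cdot>\<^sub>v v"
    using Cc by (auto simp: eigenvalue_def eigenvector_def)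
  define r where "r = vnorm v"
  have r: "0 < r"
    using v(2) vnorm_eq_0_iff[OF v(1)] vnorm_nonneg[of v] unfolding r_def by linarith
  show ?thesis
  proof
    show "(1 / r) \<cdot>\<^sub>v v \<in> carrier_vec n" "vnorm ((1 / r) \<cdot>\<^sub>v v) = 1"
      using v(1) r by (auto simp: vnorm_smult r_def)
    show "((1 / r) \<cdot>\<^sub>v v) \<bullet> (C *\<^sub>v ((1 / r) \<cdot>\<^sub>v v)) = lambda_min C"
      using r by (simp add: mult_mat_vec[OF Cc v(1)] v(3) scalar_self_eq_vnorm_sq power2_eq_square
          flip: r_def)
  qed
qed

section \<open>Matrix pencils\<close>

lemma sym_mat_pencil:
  assumes "sym_mat n A" "sym_mat n B"
  shows "sym_mat n (pencil A B \<mu>)"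
proof -
  have c: "A \<in> carrier_mat n n" "B \<in> carrier_mat n n"
    and t: "transpose_mat A = A" "transpose_mat B = B"
    using assms by (auto simp: sym_mat_def)
  have "transpose_mat (\<mu> \<cdot>\<^sub>m A + (1 - \<mu>) \<cdot>\<^sub>m B) = \<mu> \<cdot>\<^sub>m transpose_mat A + (1 - \<mu>) \<cdot>\<^sub>m transpose_mat B"
    using c by (intro eq_matI) auto
  then show ?thesis
    using c t by (simp add: sym_mat_def pencil_def)
qed

lemma smult_mult_mat_vec:
  assumes "C \<in> carrier_mat m n" "x \<in> carrier_vec n"
  shows "(k \<cdot>\<^sub>m C) *\<^sub>v x = k \<cdot>\<^sub>v (C *\<^sub>v (x :: real vec))"
  using assms by (intro eq_vecI) auto

lemma pencil_mult_vec:
  assumes "A \<in> carrier_mat n n" "B \<in> carrier_mat n n" "x \<in> carrier_vec n"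
  shows "pencil A B \<mu> *\<^sub>v x = \<mu> \<cdot>\<^sub>v (A *\<^sub>v x) + (1 - \<mu>) \<cdot>\<^sub>v (B *\<^sub>v x)"
  using assms unfolding pencil_def
  by (subst add_mult_distrib_mat_vec[of _ n n]) (auto simp: smult_mult_mat_vec[of _ n n])

lemma quad_form_pencil:
  assumes "A \<in> carrier_mat n n" "B \<in> carrier_mat n n" "x \<in> carrier_vec n"
  shows "x \<bullet> (pencil A B \<mu> *\<^sub>v x) = \<mu> * (x \<bullet> (A *\<^sub>v x)) + (1 - \<mu>) * (x \<bullet> (B *\<^sub>v x))"
  using assms by (simp add: pencil_mult_vec[of _ n] scalar_prod_add_distrib[of _ n])

lemma op_norm_pencil_le:
  assumes A: "A \<in> carrier_mat n n" and B: "B \<in> carrier_mat n n" and n: "0 < n"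
    and \<mu>: "0 \<le> \<mu>" "\<mu> \<le> 1"
  shows "op_norm (pencil A B \<mu>) \<le> op_norm A + op_norm B"
proof (rule op_norm_leI)
  show "pencil A B \<mu> \<in> carrier_mat n n"
    using A B by (simp add: pencil_def)
  fix x :: "real vec" assume x: "x \<in> carrier_vec n" and x1: "vnorm x \<le> 1"
  have le: "vnorm (k \<cdot>\<^sub>v (C *\<^sub>v x)) \<le> op_norm C" 
    if "C \<in> carrier_mat n n" "0 \<le> k" "k \<le> 1" for C k
  proof -
    have "vnorm (C *\<^sub>v x) \<le> op_norm C * vnorm x"
      using that(1) x by (rule vnorm_mult_mat_vec_le)
    also have "\<dots> \<le> op_norm C"
      using op_norm_nonneg[OF that(1) n] x1 mult_left_le by blast
    finally have "k * vnorm (C *\<^sub>v x) \<le> 1 * op_norm C"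
      using that by (intro mult_mono) auto
    then show ?thesis using that by (simp add: vnorm_smult)
  qed
  have "vnorm (pencil A B \<mu> *\<^sub>v x) \<le> vnorm (\<mu> \<cdot>\<^sub>v (A *\<^sub>v x)) + vnorm ((1 - \<mu>) \<cdot>\<^sub>v (B *\<^sub>v x))"
    using A B x by (simp add: pencil_mult_vec[of _ n] vnorm_triangle[of _ n])
  then show "vnorm (pencil A B \<mu> *\<^sub>v x) \<le> op_norm A + op_norm B"
    using le[OF A, of \<mu>] le[OF B, of "1 - \<mu>"] \<mu> by simp
qed

lemma nnz_pencil_le:
  assumes "A \<in> carrier_mat n n" "B \<in> carrier_mat n n"
  shows "nnz (pencil A B \<mu>) \<le> nnz A + nnz B"
proof -
  define E where "E C = {(i, j). i < n \<and> j < n \<and> C $$ (i, j) \<noteq> (0 :: real)}" for C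
  have fin: "finite (E C)" for C
    by (rule finite_subset[of _ "{..<n} \<times> {..<n}"]) (auto simp: E_def)
  have "nnz (pencil A B \<mu>) = card (E (pencil A B \<mu>))"
    using assms by (simp add: nnz_def E_def pencil_def)
  also have "\<dots> \<le> card (E A \<union> E B)"
    using assms fin by (intro card_mono) (auto simp: E_def pencil_def)
  also have "\<dots> \<le> card (E A) + card (E B)"
    by (rule card_Un_le)
  also have "\<dots> = nnz A + nnz B"
    using assms by (simp add: nnz_def E_def)
  finally show ?thesis .
qed

section \<open>A union bound for adaptively chosen experiments\<close>

text \<open>The experiments are indexed by states. In state \<open>st\<close> a fresh seed is drawn, it should fall
  into \<open>G st\<close>, and it determines the next state by \<open>nx\<close>.\<close>
fun adaptive_success ::
  "('st \<Rightarrow> 'r set) \<Rightarrow> ('st \<Rightarrow> 'r \<Rightarrow> 'st) \<Rightarrow> nat \<Rightarrow> 'st \<Rightarrow> (nat \<Rightarrow> 'r) \<Rightarrow> bool" where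
  "adaptive_success G nx 0 st \<omega> = True"
| "adaptive_success G nx (Suc k) st \<omega> =
     (\<omega> 0 \<in> G st \<and> adaptive_success G nx k (nx st (\<omega> 0)) (\<lambda>j. \<omega> (Suc j)))"

text \<open>Each experiment fails with probability at most \<open>\<theta>\<close> in every state that it can be started from, but
  which one is carried out depends on earlier seeds. The union bound over the \<open>k\<close> experiments that
  are carried out nevertheless holds, since the next seed is independent of the state reached. Only
  countably many states may follow a given one, so the success event is a countable union over the
  next state and hence measurable.\<close>
lemma (in prob_space) adaptive_union_bound:
  fixes V :: "'st set"
  assumes G: "\<And>st. st \<in> V \<Longrightarrow> G st \<in> sets M" "\<And>st. st \<in> V \<Longrightarrow> 1 - \<theta> \<le> prob (G st)"
    and nx: "\<And>st. st \<in> V \<Longrightarrow> nx st \<in> M \<rightarrow>\<^sub>M count_space (D st)"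
      "\<And>st. st \<in> V \<Longrightarrow> countable (D st)" "\<And>st. st \<in> V \<Longrightarrow> D st \<subseteq> V"
    and \<theta>: "0 \<le> \<theta>"
  defines "S \<equiv> PiM UNIV (\<lambda>i :: nat. M)"
  assumes "st \<in> V"
  shows "{\<omega> \<in> space S. adaptive_success G nx k st \<omega>} \<in> sets S" (is "?meas k st")
    and "measure S {\<omega> \<in> space S. \<not> adaptive_success G nx k st \<omega>} \<le> real k * \<theta>" (is "?prob k st")
proof -
  have M: "prob_space M"
    by unfold_locales
  interpret seqs: sequence_space M ..
  have S: "S = PiM UNIV (\<lambda>i :: nat. M)"
    by (simp add: S_def)
  interpret Q: prob_space S
    unfolding S by (rule prob_space_PiM) (rule M)
  have step [measurable]: "(\<lambda>(s, \<omega>). case_nat s \<omega>) \<in> M \<Otimes>\<^sub>M S \<rightarrow>\<^sub>M S"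
    unfolding S by measurable
  have "?meas k st \<and> ?prob k st"
    using \<open>st \<in> V\<close>
  proof (induction k arbitrary: st)
    case 0
    then show ?case by simp
  next
    case (Suc k)
    have IH: "Measurable.pred S (adaptive_success G nx k st')" "?prob k st'" if "st' \<in> V" for st'
      using Suc.IH[OF that] by (auto simp: pred_def)
    have [measurable]: "G st \<in> sets M" "nx st \<in> M \<rightarrow>\<^sub>M count_space (D st)"
      using G nx Suc.prems by auto
    have shift [measurable]: "(\<lambda>\<omega> j. \<omega> (Suc j)) \<in> S \<rightarrow>\<^sub>M S"
      unfolding S by (rule measurable_PiM_single') (auto simp: space_PiM)
    have [measurable]: "(\<lambda>\<omega>. \<omega> 0) \<in> S \<rightarrow>\<^sub>M M"
      unfolding S by measurable
    have rest [measurable]: "Measurable.pred S (\<lambda>\<omega>. adaptive_success G nx k (nx st (\<omega> 0)) (\<lambda>j. \<omega> (Suc j)))"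
    proof (rule measurable_compose_countable'[where I = "D st"])
      show "(\<lambda>\<omega>. nx st (\<omega> 0)) \<in> S \<rightarrow>\<^sub>M count_space (D st)"
        by measurable
      show "countable (D st)"
        using nx Suc.prems by auto
      fix st' assume "st' \<in> D st"
      then have [measurable]: "Measurable.pred S (adaptive_success G nx k st')"
        using IH(1) nx(3)[OF Suc.prems] by auto
      show "Measurable.pred S (\<lambda>\<omega>. adaptive_success G nx k st' (\<lambda>j. \<omega> (Suc j)))"
        by measurable
    qed
    have meas [measurable]: "Measurable.pred S (adaptive_success G nx (Suc k) st)"
      unfolding adaptive_success.simps by measurable
    let ?F = "{\<omega> \<in> space S. \<not> adaptive_success G nx (Suc k) st \<omega>}"
    have F [measurable]: "?F \<in> sets S"
      by measurable
    \<comment> \<open>Fubini over the first seed: once it is fixed, the remaining experiments start from a fixed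
      state, to which the induction hypothesis applies.\<close>
    have "emeasure S ?F = emeasure (distr (M \<Otimes>\<^sub>M S) S (\<lambda>(s, \<omega>). case_nat s \<omega>)) ?F"
      using seqs.PiM_iter by (simp add: S)
    also have "\<dots> = emeasure (M \<Otimes>\<^sub>M S) ((\<lambda>(s, \<omega>). case_nat s \<omega>) -` ?F \<inter> space (M \<Otimes>\<^sub>M S))"
      by (rule emeasure_distr[OF step F])
    also have "\<dots> = (\<integral>\<^sup>+ s. emeasure S (Pair s -` ((\<lambda>(s, \<omega>). case_nat s \<omega>) -` ?F \<inter> space (M \<Otimes>\<^sub>M S))) \<partial>M)"
      by (rule Q.emeasure_pair_measure_alt[OF measurable_sets[OF step F]])
    also have "\<dots> \<le> (\<integral>\<^sup>+ s. indicator (space M - G st) s + ennreal (real k * \<theta>) \<partial>M)"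
    proof (rule nn_integral_mono)
      fix s assume s: "s \<in> space M"
      let ?X = "Pair s -` ((\<lambda>(s, \<omega>). case_nat s \<omega>) -` ?F \<inter> space (M \<Otimes>\<^sub>M S))"
      show "emeasure S ?X \<le> indicator (space M - G st) s + ennreal (real k * \<theta>)"
      proof (cases "s \<in> G st")
        case True
        have V: "nx st s \<in> V"
          using measurable_space[OF nx(1)[OF Suc.prems] s] nx(3)[OF Suc.prems] by auto
        have "?X \<subseteq> {\<omega> \<in> space S. \<not> adaptive_success G nx k (nx st s) \<omega>}"
          using True by (auto simp: space_pair_measure)
        then have "emeasure S ?X \<le> emeasure S {\<omega> \<in> space S. \<not> adaptive_success G nx k (nx st s) \<omega>}"
          using IH(1)[OF V] by (intro emeasure_mono) auto
        also have "\<dots> \<le> ennreal (real k * \<theta>)"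
          using IH(2)[OF V] by (simp add: Q.emeasure_eq_measure ennreal_leI)
        finally show ?thesis using True by simp
      next
        case False
        then show ?thesis
          using s Q.emeasure_le_1[of ?X] by (simp add: add_increasing2)
      qed
    qed
    also have "\<dots> = emeasure M (space M - G st) + ennreal (real k * \<theta>)"
      by (subst nn_integral_add) (auto simp: prob_space.emeasure_space_1[OF M])
    also have "\<dots> \<le> ennreal \<theta> + ennreal (real k * \<theta>)"
      using G(2)[OF Suc.prems] prob_compl[of "G st"] G(1)[OF Suc.prems]
      by (intro add_right_mono) (simp add: emeasure_eq_measure ennreal_leI)
    also have "\<dots> = ennreal (real (Suc k) * \<theta>)"
      using \<theta> by (subst ennreal_plus[symmetric]) (auto simp: algebra_simps)
    finally have "measure S ?F \<le> real (Suc k) * \<theta>"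
      using \<theta> by (simp add: Q.emeasure_eq_measure)
    then show ?case
      using meas by (simp add: pred_def)
  qed
  then show "?meas k st" "?prob k st" by auto
qed

section \<open>The bisection on the pencil\<close>

text \<open>The parameter \<open>\<theta>\<close> is the failure probability allowed to a single solver call in the bisection. The
  hypothesis on the norms makes \<open>\<phi>\<close> a valid norm bound for the whole segment between \<open>A\<close> and \<open>B\<close>.\<close>
locale pencil_search =
  fixes R :: "'r measure" and orc :: "'r ev_solver" and \<kappa> :: real
    and n :: nat and A B :: "real mat" and \<xi> \<phi> \<theta> :: real
  assumes solver: "approx_min_ev R orc \<kappa>"
    and n_pos: "0 < n" and symA: "sym_mat n A" and symB: "sym_mat n B"
    and norms_le: "op_norm A + op_norm B \<le> \<phi>"
    and xi_pos: "0 < \<xi>" and theta_pos: "0 < \<theta>"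
begin

lemma A_carrier: "A \<in> carrier_mat n n" and B_carrier: "B \<in> carrier_mat n n"
  using symA symB by (auto simp: sym_mat_def)

lemma prob_space_R: "prob_space R"
  using solver by (simp add: approx_min_ev_def)

lemmas solver_spec = solver[unfolded approx_min_ev_def, THEN conjunct2, THEN spec[of _ n],
    THEN spec, THEN spec, THEN spec, THEN spec, THEN mp, OF conjI, OF n_pos, OF conjI,
    OF _ conjI, OF _ _ conjI]

lemma solver_point:
  assumes "sym_mat n C" "op_norm C \<le> \<rho>" "0 < \<eta>" "0 < \<theta>'" "s \<in> space R"
    and "orc s C \<rho> \<eta> \<theta>' = (lam, x, t)"
  shows "x \<in> carrier_vec n" "vnorm x = 1" "lam = x \<bullet> (C *\<^sub>v x)"
  using solver_spec[OF assms(1-4), THEN conjunct1, THEN bspec, OF assms(5)] assms(6) by auto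

lemma solver_time:
  assumes "sym_mat n C" "op_norm C \<le> \<rho>" "0 < \<eta>" "0 < \<theta>'" "s \<in> space R"
    and "orc s C \<rho> \<eta> \<theta>' = (lam, x, t)" "\<eta> \<le> \<rho>" "\<theta>' \<le> 1/2" "n \<le> N" "nnz C \<le> N"
  shows "real t \<le> \<kappa> * (real N * sqrt \<rho> / sqrt \<eta> * ln (real n / \<theta>'))"
  using solver_spec[OF assms(1-4), THEN conjunct2, THEN conjunct2, THEN conjunct2, THEN mp,
      OF conjI[OF assms(7,8)], THEN bspec, OF assms(5), THEN spec, THEN mp,
      OF conjI[OF assms(9,10)]] assms(6)
  by auto

lemma solver_good_seeds:
  assumes "sym_mat n C" "op_norm C \<le> \<rho>" "0 < \<eta>" "0 < \<theta>'"
  obtains E where "E \<in> sets R" "1 - \<theta>' \<le> measure R E"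
    "\<And>s lam x t. s \<in> E \<Longrightarrow> orc s C \<rho> \<eta> \<theta>' = (lam, x, t) \<Longrightarrow> lam \<le> lambda_min C + \<eta>"
proof -
  obtain E where E: "E \<in> sets R" "1 - \<theta>' \<le> measure R E"
    "\<And>s. s \<in> E \<Longrightarrow> case orc s C \<rho> \<eta> \<theta>' of (lam, x, t) \<Rightarrow> x \<bullet> (C *\<^sub>v x) \<le> lambda_min C + \<eta>"
    using solver_spec[OF assms, THEN conjunct2, THEN conjunct2, THEN conjunct1]
    unfolding holds_with_prob_def by (elim bexE conjE) (rule that, auto)
  show ?thesis
  proof
    fix s lam x t assume s: "s \<in> E" "orc s C \<rho> \<eta> \<theta>' = (lam, x, t)"
    then have "s \<in> space R"
      using E(1) sets.sets_into_space by blast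
    then show "lam \<le> lambda_min C + \<eta>"
      using solver_point(3)[OF assms _ s(2)] E(3)[OF s(1)] s(2) by auto
  qed (use E in auto)
qed

lemma solver_coord_measurable:
  assumes "sym_mat n C" "op_norm C \<le> \<rho>" "0 < \<eta>" "0 < \<theta>'" "i < n"
  shows "(\<lambda>s. fst (snd (orc s C \<rho> \<eta> \<theta>')) $ i) \<in> borel_measurable R"
  using solver_spec[OF assms(1-4), THEN conjunct2, THEN conjunct1, THEN spec, THEN mp, OF assms(5)]
  by (simp add: case_prod_unfold)

lemma solver_quad_form_measurable:
  assumes C: "sym_mat n C" "op_norm C \<le> \<rho>" "0 < \<eta>" "0 < \<theta>'" and Q: "Q \<in> carrier_mat n n"
  shows "(\<lambda>s. fst (snd (orc s C \<rho> \<eta> \<theta>')) \<bullet> (Q *\<^sub>v fst (snd (orc s C \<rho> \<eta> \<theta>'))))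
           \<in> borel_measurable R"
proof -
  define X where "X s = fst (snd (orc s C \<rho> \<eta> \<theta>'))" for s
  have [measurable]: "(\<lambda>s. X s $ i) \<in> borel_measurable R" if "i \<in> {0..<n}" for i
    using solver_coord_measurable[OF C] that by (simp add: X_def)
  have "(\<lambda>s. \<Sum>i = 0..<n. X s $ i * (\<Sum>j = 0..<n. Q $$ (i, j) * X s $ j)) \<in> borel_measurable R"
    by measurable
  moreover have "X s \<bullet> (Q *\<^sub>v X s) = (\<Sum>i = 0..<n. X s $ i * (\<Sum>j = 0..<n. Q $$ (i, j) * X s $ j))"
    if "s \<in> space R" for s
  proof -
    have "X s \<in> carrier_vec n"
      using solver_point(1)[OF C that] by (metis X_def prod.collapse)
    then show ?thesis
      using Q by (simp add: scalar_prod_def)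
  qed
  ultimately show ?thesis
    unfolding X_def by (subst measurable_cong) auto
qed

text \<open>Only the existence of a measurable event of good seeds is given for each matrix; a fixed choice is
  needed so that success of the whole search becomes one event.\<close>
definition good_seeds :: "real \<Rightarrow> 'r set" where
  "good_seeds \<mu> = (SOME E. E \<in> sets R \<and> 1 - \<theta> \<le> measure R E \<and>
     (\<forall>s \<in> E. fst (orc s (pencil A B \<mu>) \<phi> (\<xi> / 4) \<theta>) \<le> lambda_min (pencil A B \<mu>) + \<xi> / 4))"

lemma pencil_props:
  assumes "0 \<le> \<mu>" "\<mu> \<le> 1"
  shows "sym_mat n (pencil A B \<mu>)" "op_norm (pencil A B \<mu>) \<le> \<phi>"
  using sym_mat_pencil[OF symA symB] op_norm_pencil_le[OF A_carrier B_carrier n_pos assms] norms_le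
  by auto

lemma good_seeds_props:
  assumes "0 \<le> \<mu>" "\<mu> \<le> 1"
  shows "good_seeds \<mu> \<in> sets R" "1 - \<theta> \<le> measure R (good_seeds \<mu>)"
    "s \<in> good_seeds \<mu> \<Longrightarrow> orc s (pencil A B \<mu>) \<phi> (\<xi> / 4) \<theta> = (lam, x, t) \<Longrightarrow>
       lam \<le> lambda_min (pencil A B \<mu>) + \<xi> / 4"
proof -
  obtain E where E: "E \<in> sets R" "1 - \<theta> \<le> measure R E"
    "\<And>s lam x t. s \<in> E \<Longrightarrow> orc s (pencil A B \<mu>) \<phi> (\<xi> / 4) \<theta> = (lam, x, t) \<Longrightarrow>
       lam \<le> lambda_min (pencil A B \<mu>) + \<xi> / 4"
    using solver_good_seeds[OF pencil_props[OF assms], of "\<xi> / 4" \<theta>] xi_pos theta_pos by auto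
  have "good_seeds \<mu> \<in> sets R \<and> 1 - \<theta> \<le> measure R (good_seeds \<mu>) \<and>
     (\<forall>s \<in> good_seeds \<mu>. fst (orc s (pencil A B \<mu>) \<phi> (\<xi> / 4) \<theta>) \<le> lambda_min (pencil A B \<mu>) + \<xi> / 4)"
    unfolding good_seeds_def
  proof (rule someI[of _ E], intro conjI ballI)
    fix s assume "s \<in> E"
    then show "fst (orc s (pencil A B \<mu>) \<phi> (\<xi> / 4) \<theta>) \<le> lambda_min (pencil A B \<mu>) + \<xi> / 4"
      by (metis E(3) prod.collapse)
  qed (use E in auto)
  then show "good_seeds \<mu> \<in> sets R" "1 - \<theta> \<le> measure R (good_seeds \<mu>)"
    "s \<in> good_seeds \<mu> \<Longrightarrow> orc s (pencil A B \<mu>) \<phi> (\<xi> / 4) \<theta> = (lam, x, t) \<Longrightarrow>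
       lam \<le> lambda_min (pencil A B \<mu>) + \<xi> / 4"
    by (auto dest!: bspec)
qed

text \<open>The states of the search are its brackets \<open>(\<mu>1, \<mu>2)\<close>, and \<^const>\<open>None\<close> after it has returned. The
  transition function is the loop body of \<^const>\<open>psd_loop\<close>, with the eigenvalue estimate replaced by the
  quadratic form that it equals, because only the coordinates of the vector are known to be
  measurable.\<close>
fun bracket_good :: "(real \<times> real) option \<Rightarrow> 'r set" where
  "bracket_good None = space R"
| "bracket_good (Some (\<mu>1, \<mu>2)) = good_seeds ((\<mu>1 + \<mu>2) / 2)"

fun bracket_next :: "(real \<times> real) option \<Rightarrow> 'r \<Rightarrow> (real \<times> real) option" where
  "bracket_next None s = None"
| "bracket_next (Some (\<mu>1, \<mu>2)) s =
     (let \<mu> = (\<mu>1 + \<mu>2) / 2; x = fst (snd (orc s (pencil A B \<mu>) \<phi> (\<xi> / 4) \<theta>))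
      in if x \<bullet> (pencil A B \<mu> *\<^sub>v x) \<ge> 3 * \<xi> / 4 then None
         else if x \<bullet> (A *\<^sub>v x) > x \<bullet> (B *\<^sub>v x) then Some (\<mu>, \<mu>2) else Some (\<mu>1, \<mu>))"

definition brackets :: "(real \<times> real) option set" where
  "brackets = {None} \<union> {Some (\<mu>1, \<mu>2) | \<mu>1 \<mu>2. 0 \<le> \<mu>1 \<and> \<mu>1 \<le> \<mu>2 \<and> \<mu>2 \<le> 1}"

lemma Some_in_brackets [simp]: "Some (\<mu>1, \<mu>2) \<in> brackets \<longleftrightarrow> 0 \<le> \<mu>1 \<and> \<mu>1 \<le> \<mu>2 \<and> \<mu>2 \<le> 1"
  and None_in_brackets [simp]: "None \<in> brackets"
  by (auto simp: brackets_def)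

abbreviation search_success :: "nat \<Rightarrow> (real \<times> real) option \<Rightarrow> (nat \<Rightarrow> 'r) \<Rightarrow> bool" where
  "search_success \<equiv> adaptive_success bracket_good bracket_next"

lemma search_success_prob:
  fixes k :: nat
  defines "S \<equiv> PiM UNIV (\<lambda>i :: nat. R)"
  shows "{\<omega> \<in> space S. search_success k (Some (0, 1)) \<omega>} \<in> sets S"
    and "measure S {\<omega> \<in> space S. \<not> search_success k (Some (0, 1)) \<omega>} \<le> real k * \<theta>"
proof -
  interpret prob_space R by (rule prob_space_R)
  define D where "D st = (case st of None \<Rightarrow> {None} | Some (\<mu>1, \<mu>2) \<Rightarrow>
    {None, Some ((\<mu>1 + \<mu>2) / 2, \<mu>2), Some (\<mu>1, (\<mu>1 + \<mu>2) / 2)})" for st :: "(real \<times> real) option"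
  have good: "bracket_good st \<in> sets R \<and> 1 - \<theta> \<le> prob (bracket_good st)" if "st \<in> brackets" for st
    using that good_seeds_props(1,2) theta_pos by (auto simp: brackets_def prob_space)
  have nx: "bracket_next st \<in> R \<rightarrow>\<^sub>M count_space (D st)" if br: "st \<in> brackets" for st
  proof (cases st)
    case None
    moreover have "bracket_next None = (\<lambda>s. None)"
      by (simp add: fun_eq_iff)
    ultimately show ?thesis by (simp add: D_def)
  next
    case (Some p)
    then obtain \<mu>1 \<mu>2 where st: "st = Some (\<mu>1, \<mu>2)" and \<mu>: "0 \<le> \<mu>1" "\<mu>1 \<le> \<mu>2" "\<mu>2 \<le> 1"
      using br by (auto simp: brackets_def)
    define \<mu> where "\<mu> = (\<mu>1 + \<mu>2) / 2"
    define X where "X s = fst (snd (orc s (pencil A B \<mu>) \<phi> (\<xi> / 4) \<theta>))" for s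
    have [measurable]: "(\<lambda>s. X s \<bullet> (Q *\<^sub>v X s)) \<in> borel_measurable R" if "Q \<in> carrier_mat n n" for Q
      unfolding X_def using \<mu> xi_pos theta_pos that
      by (intro solver_quad_form_measurable pencil_props) (auto simp: \<mu>_def)
    have [simp]: "A \<in> carrier_mat n n" "B \<in> carrier_mat n n" "pencil A B \<mu> \<in> carrier_mat n n"
      using A_carrier B_carrier by (auto simp: pencil_def)
    have cond [measurable]: "{s \<in> space R. 3 * \<xi> / 4 \<le> X s \<bullet> (pencil A B \<mu> *\<^sub>v X s)} \<in> sets R"
      "{s \<in> space R. X s \<bullet> (B *\<^sub>v X s) < X s \<bullet> (A *\<^sub>v X s)} \<in> sets R"
      by measurable
    have "(\<lambda>s. if X s \<bullet> (pencil A B \<mu> *\<^sub>v X s) \<ge> 3 * \<xi> / 4 then None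
         else if X s \<bullet> (A *\<^sub>v X s) > X s \<bullet> (B *\<^sub>v X s) then Some (\<mu>, \<mu>2) else Some (\<mu>1, \<mu>))
       \<in> R \<rightarrow>\<^sub>M count_space (D st)"
      by (intro measurable_If measurable_const cond) (auto simp: D_def st \<mu>_def)
    moreover have "bracket_next st = (\<lambda>s. if X s \<bullet> (pencil A B \<mu> *\<^sub>v X s) \<ge> 3 * \<xi> / 4 then None
         else if X s \<bullet> (A *\<^sub>v X s) > X s \<bullet> (B *\<^sub>v X s) then Some (\<mu>, \<mu>2) else Some (\<mu>1, \<mu>))"
      by (rule ext) (simp add: st Let_def X_def \<mu>_def)
    ultimately show ?thesis
      by (simp only:)
  qed
  have D: "countable (D st)" "D st \<subseteq> brackets" if "st \<in> brackets" for st
    using that by (auto simp: D_def split: option.splits)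
  show "{\<omega> \<in> space S. search_success k (Some (0, 1)) \<omega>} \<in> sets S"
    and "measure S {\<omega> \<in> space S. \<not> search_success k (Some (0, 1)) \<omega>} \<le> real k * \<theta>"
    unfolding S_def
    using adaptive_union_bound[of brackets bracket_good \<theta> bracket_next D "Some (0, 1)" k] good nx D theta_pos
    by (auto simp: brackets_def)
qed

text \<open>That the search returns something does not depend on luck. If the call at \<open>\<mu>\<close> yields \<open>lam < 3 * \<xi> / 4\<close>
  with vector \<open>x\<close>, then the affine function \<open>\<mu>' \<mapsto> x \<bullet> pencil A B \<mu>' x\<close> is below \<open>3 * \<xi> / 4\<close> at \<open>\<mu>\<close> and at
  least \<open>\<xi>\<close> at the definite point \<open>\<mu>s\<close>. Its slope therefore tells on which side of \<open>\<mu>\<close> the point \<open>\<mu>s\<close> lies,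
  and since the slope is at most \<open>\<phi>\<close>, its distance from \<open>\<mu>\<close> exceeds \<open>\<xi> / (4 * \<phi>)\<close>.
  The bracket always contains \<open>\<mu>s\<close>, and in the last iteration its length is at most \<open>\<xi> / (4 * \<phi>)\<close>, so this
  cannot happen at its midpoint. Good seeds matter
  only for the returned estimate \<open>lam\<close> not being too far above the smallest eigenvalue.\<close>
lemma psd_loop_result:
  assumes \<mu>s: "0 < \<mu>s" "\<mu>1 \<le> \<mu>s" "\<mu>s \<le> \<mu>2"
    and psd: "\<And>x. x \<in> carrier_vec n \<Longrightarrow> vnorm x = 1 \<Longrightarrow> \<xi> \<le> x \<bullet> (pencil A B \<mu>s *\<^sub>v x)"
    and \<omega>: "\<omega> \<in> UNIV \<rightarrow> space R"
    and "0 \<le> \<mu>1" "\<mu>2 \<le> 1" "0 < k" "(\<mu>2 - \<mu>1) * (8 * \<phi>) \<le> 2 ^ k * \<xi>"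
  shows "\<exists>\<mu>0 lam x t. psd_loop orc w A B \<xi> \<phi> \<theta> \<omega> k i \<mu>1 \<mu>2 = (Some (\<mu>0, lam, x), t) \<and>
    0 < \<mu>0 \<and> \<mu>0 \<le> 1 \<and> 3 * \<xi> / 4 \<le> lam \<and>
    (search_success k (Some (\<mu>1, \<mu>2)) (\<lambda>j. \<omega> (i + j)) \<longrightarrow> lam \<le> lambda_min (pencil A B \<mu>0) + \<xi> / 4)"
  using assms(2,3,6-9)
proof (induction k arbitrary: i \<mu>1 \<mu>2)
  case 0
  then show ?case by simp
next
  case (Suc k)
  define \<mu> where "\<mu> = (\<mu>1 + \<mu>2) / 2"
  have \<mu>: "0 < \<mu>" "\<mu> \<le> 1" "\<mu>1 \<le> \<mu>" "\<mu> \<le> \<mu>2"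
    using Suc.prems \<mu>s(1) by (auto simp: \<mu>_def)
  obtain lam x t where orc: "orc (\<omega> i) (pencil A B \<mu>) \<phi> (\<xi> / 4) \<theta> = (lam, x, t)"
    by (metis prod.collapse)
  have x: "x \<in> carrier_vec n" "vnorm x = 1" "lam = x \<bullet> (pencil A B \<mu> *\<^sub>v x)"
    using solver_point[OF pencil_props _ _ _ orc] \<mu> xi_pos theta_pos \<omega> by auto
  show ?case
  proof (cases "3 * \<xi> / 4 \<le> lam")
    case True
    have "lam \<le> lambda_min (pencil A B \<mu>) + \<xi> / 4" if "\<omega> i \<in> good_seeds \<mu>"
      using good_seeds_props(3)[OF _ _ that orc] \<mu> by auto
    moreover have "psd_loop orc w A B \<xi> \<phi> \<theta> \<omega> (Suc k) i \<mu>1 \<mu>2 =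
        (Some (\<mu>, lam, x), t + w * (nnz A + nnz B))"
      using True orc by (simp add: Let_def flip: \<mu>_def)
    moreover have "search_success (Suc k) (Some (\<mu>1, \<mu>2)) (\<lambda>j. \<omega> (i + j)) \<longrightarrow> \<omega> i \<in> good_seeds \<mu>"
      by (simp flip: \<mu>_def)
    ultimately show ?thesis
      using True \<mu> by blast
  next
    case False
    let ?a = "x \<bullet> (A *\<^sub>v x)" and ?b = "x \<bullet> (B *\<^sub>v x)"
    define \<mu>1' where "\<mu>1' = (if ?b < ?a then \<mu> else \<mu>1)"
    define \<mu>2' where "\<mu>2' = (if ?b < ?a then \<mu>2 else \<mu>)"

    have gap: "\<xi> / 4 < (\<mu>s - \<mu>) * (?a - ?b)"
    proof -
      have "(\<mu>s - \<mu>) * (?a - ?b) = x \<bullet> (pencil A B \<mu>s *\<^sub>v x) - lam"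
        using x(1) A_carrier B_carrier by (simp add: x(3) quad_form_pencil[of _ n] algebra_simps)
      then show ?thesis
        using psd[OF x(1,2)] False by simp
    qed
    have "0 < (\<mu>s - \<mu>) * (?a - ?b)"
      using gap xi_pos by linarith
    then have br: "\<mu>1' \<le> \<mu>s" "\<mu>s \<le> \<mu>2'"
      using Suc.prems(1,2) by (auto simp: \<mu>1'_def \<mu>2'_def zero_less_mult_iff)
    have half: "\<mu>2' - \<mu>1' = (\<mu>2 - \<mu>1) / 2"
      by (simp add: \<mu>1'_def \<mu>2'_def \<mu>_def field_simps)
    have "k \<noteq> 0"
    proof
      assume "k = 0"
      have "\<bar>?a\<bar> + \<bar>?b\<bar> \<le> \<phi>"
        using quad_form_le_op_norm[OF A_carrier x(1)] quad_form_le_op_norm[OF B_carrier x(1)] norms_le x(2)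
        by simp
      then have ab: "\<bar>?a - ?b\<bar> \<le> \<phi>" by linarith
      have "\<bar>\<mu>s - \<mu>\<bar> \<le> (\<mu>2 - \<mu>1) / 2"
        using Suc.prems(1,2) by (auto simp: \<mu>_def abs_le_iff field_simps)
      then have "\<bar>\<mu>s - \<mu>\<bar> * \<bar>?a - ?b\<bar> \<le> (\<mu>2 - \<mu>1) / 2 * \<phi>"
        using ab Suc.prems(1,2) by (intro mult_mono) auto
      then have "(\<mu>s - \<mu>) * (?a - ?b) \<le> (\<mu>2 - \<mu>1) / 2 * \<phi>"
        using abs_ge_self[of "(\<mu>s - \<mu>) * (?a - ?b)"] by (simp add: abs_mult)
      also have "(\<mu>2 - \<mu>1) / 2 * \<phi> \<le> \<xi> / 8"
        using Suc.prems(6) \<open>k = 0\<close> by simp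
      finally show False
        using gap xi_pos by linarith
    qed
    moreover have "0 \<le> \<mu>1'" "\<mu>2' \<le> 1"
      using \<mu> Suc.prems by (auto simp: \<mu>1'_def \<mu>2'_def)
    moreover have "(\<mu>2' - \<mu>1') * (8 * \<phi>) \<le> 2 ^ k * \<xi>"
      using Suc.prems(6) by (simp add: half mult.commute)
    ultimately obtain \<mu>0 lam' x' t' where IH:
      "psd_loop orc w A B \<xi> \<phi> \<theta> \<omega> k (Suc i) \<mu>1' \<mu>2' = (Some (\<mu>0, lam', x'), t')"
      "0 < \<mu>0" "\<mu>0 \<le> 1" "3 * \<xi> / 4 \<le> lam'"
      "search_success k (Some (\<mu>1', \<mu>2')) (\<lambda>j. \<omega> (Suc i + j)) \<longrightarrow> lam' \<le> lambda_min (pencil A B \<mu>0) + \<xi> / 4"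
      using Suc.IH[of \<mu>1' \<mu>2' "Suc i"] br by blast
    have "psd_loop orc w A B \<xi> \<phi> \<theta> \<omega> (Suc k) i \<mu>1 \<mu>2 =
        (Some (\<mu>0, lam', x'), t + w * (nnz A + nnz B) + t')"
      using False orc IH(1) by (simp add: Let_def \<mu>_def[symmetric] \<mu>1'_def \<mu>2'_def split: if_splits)
    moreover have "search_success (Suc k) (Some (\<mu>1, \<mu>2)) (\<lambda>j. \<omega> (i + j)) \<longrightarrow>
        search_success k (Some (\<mu>1', \<mu>2')) (\<lambda>j. \<omega> (Suc i + j))"
      using False orc x(3) by (simp add: Let_def \<mu>_def[symmetric] \<mu>1'_def \<mu>2'_def)
    ultimately show ?thesis using IH by auto
  qed
qed

lemma psd_loop_time:
  assumes \<tau>: "\<And>\<mu> s lam x t. 0 \<le> \<mu> \<Longrightarrow> \<mu> \<le> 1 \<Longrightarrow> s \<in> space R \<Longrightarrow>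
      orc s (pencil A B \<mu>) \<phi> (\<xi> / 4) \<theta> = (lam, x, t) \<Longrightarrow> real t \<le> \<tau>" and "0 \<le> \<tau>"
    and \<omega>: "\<omega> \<in> UNIV \<rightarrow> space R"
    and "0 \<le> \<mu>1" "\<mu>1 \<le> \<mu>2" "\<mu>2 \<le> 1"
  shows "real (snd (psd_loop orc w A B \<xi> \<phi> \<theta> \<omega> k i \<mu>1 \<mu>2)) \<le> real k * (\<tau> + real w * real (nnz A + nnz B))"
  using assms(4-6)
proof (induction k arbitrary: i \<mu>1 \<mu>2)
  case 0
  then show ?case by simp
next
  case (Suc k)
  define \<mu> where "\<mu> = (\<mu>1 + \<mu>2) / 2"
  define c where "c = \<tau> + real w * real (nnz A + nnz B)"
  have \<mu>: "0 \<le> \<mu>" "\<mu> \<le> 1" "\<mu>1 \<le> \<mu>" "\<mu> \<le> \<mu>2"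
    using Suc.prems by (auto simp: \<mu>_def)
  obtain lam x t where orc: "orc (\<omega> i) (pencil A B \<mu>) \<phi> (\<xi> / 4) \<theta> = (lam, x, t)"
    by (metis prod.collapse)
  have t: "real (t + w * (nnz A + nnz B)) \<le> c"
    using \<tau>[OF \<mu>(1,2) _ orc] \<omega> by (auto simp: c_def)
  have c: "0 \<le> c"
    using \<open>0 \<le> \<tau>\<close> by (simp add: c_def)
  have IH: "real (snd (psd_loop orc w A B \<xi> \<phi> \<theta> \<omega> k (Suc i) \<mu> \<mu>2)) \<le> real k * c"
    "real (snd (psd_loop orc w A B \<xi> \<phi> \<theta> \<omega> k (Suc i) \<mu>1 \<mu>)) \<le> real k * c"
    using Suc.IH[of \<mu> \<mu>2 "Suc i"] Suc.IH[of \<mu>1 \<mu> "Suc i"] \<mu> Suc.prems by (auto simp: c_def)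
  have "0 \<le> real k * c" using c by simp
  then have "real (snd (psd_loop orc w A B \<xi> \<phi> \<theta> \<omega> (Suc k) i \<mu>1 \<mu>2)) \<le> real (Suc k) * c"
    using t c orc IH by (simp add: Let_def \<mu>_def[symmetric] case_prod_unfold distrib_right)
  then show ?case
    by (simp only: c_def)
qed

end

section \<open>Bounds on the optimal value\<close>

text \<open>Weak duality with the multiplier \<open>\<nu> = (1 - \<mu>) / \<mu>\<close>: on the feasible set \<open>f \<ge> f + \<nu> h\<close>, and the matrix of
  \<open>f + \<nu> h\<close> is the pencil at \<open>\<mu>\<close> divided by \<open>\<mu>\<close>. The right-hand side is bounded below by a strictly
  convex quadratic in \<open>vnorm x\<close>, whose minimum gives the bound.\<close>
lemma gtrs_lower_bound:
  assumes carrier: "A \<in> carrier_mat n n" "B \<in> carrier_mat n n" "a \<in> carrier_vec n" "b \<in> carrier_vec n"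
      "x \<in> carrier_vec n"
    and feas: "con_h B b d x \<le> 0"
    and \<mu>: "0 < \<mu>" "\<mu> \<le> 1" and L: "0 < L"
    and ray: "L * (vnorm x)\<^sup>2 \<le> x \<bullet> (pencil A B \<mu> *\<^sub>v x)"
  shows "d * ((1 - \<mu>) / \<mu>) - \<mu> * (vnorm (a + ((1 - \<mu>) / \<mu>) \<cdot>\<^sub>v b))\<^sup>2 / L \<le> obj_f A a x"
proof -
  define \<nu> where "\<nu> = (1 - \<mu>) / \<mu>"
  define p where "p = a + \<nu> \<cdot>\<^sub>v b"
  define q where "q = vnorm x"
  define P where "P = vnorm p"
  have \<nu>: "0 \<le> \<nu>" "\<mu> * \<nu> = 1 - \<mu>"
    using \<mu> by (auto simp: \<nu>_def)
  have p: "p \<in> carrier_vec n" "p \<bullet> x = a \<bullet> x + \<nu> * (b \<bullet> x)"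
    using carrier by (auto simp: p_def add_scalar_prod_distrib[of _ n])
  have px: "- (P * q) \<le> p \<bullet> x"
    using scalar_prod_le_vnorm[OF p(1) carrier(5)] by (simp add: P_def q_def abs_le_iff)
  \<comment> \<open>Completing the square: \<open>\<mu> * P / L\<close> minimizes \<open>L * q\<^sup>2 - 2 * \<mu> * P * q\<close> over \<open>q\<close>.\<close>
  have "0 \<le> (L * q - \<mu> * P)\<^sup>2"
    by simp
  then have "- (\<mu>\<^sup>2 * P\<^sup>2 / L) \<le> L * q\<^sup>2 - 2 * \<mu> * (P * q)"
    using L by (simp add: field_simps power2_eq_square)
  also have "\<dots> \<le> x \<bullet> (pencil A B \<mu> *\<^sub>v x) + 2 * \<mu> * (p \<bullet> x)"
  proof -
    have "2 * \<mu> * - (P * q) \<le> 2 * \<mu> * (p \<bullet> x)"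
      using px \<mu> by (intro mult_left_mono) auto
    then show ?thesis
      using ray unfolding q_def by linarith
  qed
  also have "\<dots> = \<mu> * obj_f A a x + (\<mu> * \<nu>) * (con_h B b d x - d)"
    unfolding p(2) quad_form_pencil[OF carrier(1,2,5)] obj_f_def con_h_def \<nu>(2)[symmetric]
    by (simp add: algebra_simps)
  also have "\<dots> \<le> \<mu> * obj_f A a x - (\<mu> * \<nu>) * d"
    using mult_nonneg_nonpos[OF _ feas, of "\<mu> * \<nu>"] \<nu>(1) \<mu> by (simp add: algebra_simps)
  finally have "\<mu> * (d * \<nu> - \<mu> * P\<^sup>2 / L) \<le> \<mu> * obj_f A a x"
    by (simp add: algebra_simps power2_eq_square)
  then show ?thesis
    using \<mu> by (simp add: P_def p_def \<nu>_def)
qed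

lemma con_h_smult:
  assumes "B \<in> carrier_mat n n" "b \<in> carrier_vec n" "y \<in> carrier_vec n"
  shows "con_h B b d (\<alpha> \<cdot>\<^sub>v y) = (y \<bullet> (B *\<^sub>v y)) * \<alpha>\<^sup>2 + 2 * (b \<bullet> y) * \<alpha> + d"
  using assms by (simp add: con_h_def mult_mat_vec power2_eq_square algebra_simps)

text \<open>With negative leading coefficient, absence of a real root means that the quadratic is negative
  everywhere, so the default value \<open>0\<close> serves as well as a root.\<close>
lemma root_finder_feasible:
  assumes "root_finder rt" "p < 0"
  shows "p * (rt p q r)\<^sup>2 + 2 * q * rt p q r + r \<le> 0"
proof (cases "\<exists>\<alpha>. p * \<alpha>\<^sup>2 + 2 * q * \<alpha> + r = 0")
  case True
  then show ?thesis
    using assms(1) by (simp add: root_finder_def)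
next
  case False
  have "r \<le> 0"
  proof (rule ccontr)
    assume "\<not> r \<le> 0"
    then have disc: "0 \<le> q\<^sup>2 - p * r"
      using assms(2) mult_neg_pos[of p r] by (simp add: order_trans[of _ 0])
    \<comment> \<open>A positive value at \<open>0\<close> and a negative leading coefficient make the discriminant nonnegative.\<close>
    define \<alpha> where "\<alpha> = (- q + sqrt (q\<^sup>2 - p * r)) / p"
    have "p * \<alpha> + q = sqrt (q\<^sup>2 - p * r)"
      using assms(2) by (simp add: \<alpha>_def)
    then have "(p * \<alpha> + q)\<^sup>2 = q\<^sup>2 - p * r"
      using disc by simp
    then have "p * (p * \<alpha>\<^sup>2 + 2 * q * \<alpha> + r) = 0"
      by (simp add: power2_eq_square algebra_simps)
    then show False
      using False assms(2) by auto
  qed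
  moreover have "rt p q r = 0"
    using assms(1) False unfolding root_finder_def by presburger
  ultimately show ?thesis by simp
qed

text \<open>It does not matter which of the two roots is found: outside \<open>[-1, 1]\<close> the quadratic term of size at
  least \<open>\<xi> \<alpha>\<^sup>2 / 2\<close> must be balanced by terms of size at most \<open>3 \<phi> \<bar>\<alpha>\<bar>\<close>.\<close>
lemma root_finder_abs_le:
  assumes "root_finder rt" "0 < \<xi>" "p \<le> - (\<xi> / 2)" "\<bar>q\<bar> \<le> \<phi>" "\<bar>r\<bar> \<le> \<phi>" "\<xi> \<le> \<phi>"
  shows "\<bar>rt p q r\<bar> \<le> 6 * \<phi> / \<xi>"
proof (cases "\<exists>\<alpha>. p * \<alpha>\<^sup>2 + 2 * q * \<alpha> + r = 0")
  case True
  define \<alpha> where "\<alpha> = rt p q r"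
  have root: "p * \<alpha>\<^sup>2 + 2 * q * \<alpha> + r = 0"
    using assms(1) True by (simp add: root_finder_def \<alpha>_def)
  show ?thesis
  proof (cases "\<bar>\<alpha>\<bar> \<le> 1")
    case True
    moreover have "1 \<le> 6 * \<phi> / \<xi>"
      using assms by simp
    ultimately show ?thesis by (simp add: \<alpha>_def)
  next
    case False
    have "\<xi> / 2 * \<alpha>\<^sup>2 \<le> - p * \<alpha>\<^sup>2"
      using assms(3) by (intro mult_right_mono) auto
    also have "\<dots> = 2 * q * \<alpha> + r"
      using root by simp
    also have "\<dots> \<le> 2 * (\<bar>q\<bar> * \<bar>\<alpha>\<bar>) + \<bar>r\<bar>"
      using abs_ge_self[of "q * \<alpha>"] by (simp add: abs_mult)
    also have "\<dots> \<le> 2 * (\<phi> * \<bar>\<alpha>\<bar>) + \<phi> * \<bar>\<alpha>\<bar>"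
    proof -
      have "\<bar>q\<bar> * \<bar>\<alpha>\<bar> \<le> \<phi> * \<bar>\<alpha>\<bar>"
        using assms(4) by (intro mult_right_mono) auto
      moreover have "\<bar>r\<bar> \<le> \<phi> * \<bar>\<alpha>\<bar>"
      proof -
        have "\<phi> * 1 \<le> \<phi> * \<bar>\<alpha>\<bar>"
          using assms False by (intro mult_left_mono) auto
        then show ?thesis
          using assms(5) by linarith
      qed
      ultimately show ?thesis by linarith
    qed
    finally have "(\<xi> / 2 * \<bar>\<alpha>\<bar>) * \<bar>\<alpha>\<bar> \<le> (3 * \<phi>) * \<bar>\<alpha>\<bar>"
      by (simp add: power2_eq_square mult.assoc)
    then have "\<xi> / 2 * \<bar>\<alpha>\<bar> \<le> 3 * \<phi>"
      by (rule mult_right_le_imp_le) (use False in linarith)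
    then show ?thesis
      using assms(2) by (simp add: \<alpha>_def field_simps)
  qed
next
  case False
  then have "rt p q r = 0"
    using assms(1) unfolding root_finder_def by presburger
  then show ?thesis using assms by simp
qed

text \<open>The upper bound contributes \<open>36 + 12\<close> and the lower bound \<open>4 + 2\<close> multiples of \<open>\<phi> ^ 3 / (min \<xi> 1)\<^sup>2\<close>.
  Here \<open>\<mu>\<close> may be as small as \<open>\<xi> / (2 * \<phi>)\<close>; the vector \<open>a + \<nu> b\<close> of norm \<open>P\<close> is then large, but \<open>\<mu> * P\<close>
  is not, so that only one factor \<open>1 / \<mu>\<close> remains in \<open>\<mu> * P\<^sup>2 = (\<mu> * P)\<^sup>2 / \<mu>\<close>.\<close>
lemma gap_bound:
  fixes \<phi> \<xi> :: real
  assumes \<phi>: "1 \<le> \<phi>" and \<xi>: "0 < \<xi>" "\<xi> \<le> \<phi>"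
    and \<alpha>: "\<bar>\<alpha>\<bar> \<le> 6 * \<phi> / \<xi>" and u: "u \<le> \<phi> * \<alpha>\<^sup>2 + 2 * (\<phi> * \<bar>\<alpha>\<bar>)"
    and \<mu>: "\<xi> / 2 \<le> \<mu> * \<phi>" "0 < \<mu>" "\<mu> \<le> 1" and L: "\<xi> / 2 \<le> L"
    and P: "0 \<le> P" "\<mu> * P \<le> \<phi>" and d: "\<bar>d\<bar> \<le> \<phi>"
  shows "u - (d * ((1 - \<mu>) / \<mu>) - \<mu> * P\<^sup>2 / L) \<le> 54 * (\<phi> ^ 3 / (min \<xi> 1)\<^sup>2)"
proof -
  define \<xi>' where "\<xi>' = min \<xi> 1"
  define G where "G = \<phi> ^ 3 / \<xi>'\<^sup>2"
  have \<xi>': "0 < \<xi>'" "\<xi>' \<le> \<xi>" "\<xi>' \<le> 1"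
    using \<xi> by (auto simp: \<xi>'_def)
  have "\<xi>'\<^sup>2 \<le> \<xi>\<^sup>2"
    using \<xi>' by (intro power_mono) auto
  then have G1: "\<phi> ^ 3 / \<xi>\<^sup>2 \<le> G"
    unfolding G_def using \<phi> \<xi>' by (intro divide_left_mono) auto
  have G2: "\<phi>\<^sup>2 / \<xi> \<le> G"
    unfolding G_def
  proof (rule frac_le)
    show "\<phi>\<^sup>2 \<le> \<phi> ^ 3"
      using \<phi> by (intro power_increasing) auto
    have "\<xi>'\<^sup>2 \<le> \<xi>' * 1"
      unfolding power2_eq_square using \<xi>' by (intro mult_left_mono) auto
    then show "\<xi>'\<^sup>2 \<le> \<xi>" using \<xi>' by simp
  qed (use \<phi> \<xi>' in auto)
  have "\<alpha>\<^sup>2 \<le> (6 * \<phi> / \<xi>)\<^sup>2"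
    using power_mono[OF \<alpha>, of 2] by simp
  then have "\<phi> * \<alpha>\<^sup>2 \<le> \<phi> * (6 * \<phi> / \<xi>)\<^sup>2"
    using \<phi> by (intro mult_left_mono) auto
  also have "\<dots> = 36 * (\<phi> ^ 3 / \<xi>\<^sup>2)"
    by (simp add: power2_eq_square power3_eq_cube)
  finally have u1: "\<phi> * \<alpha>\<^sup>2 \<le> 36 * G"
    using G1 by simp
  have "\<phi> * \<bar>\<alpha>\<bar> \<le> \<phi> * (6 * \<phi> / \<xi>)"
    using \<phi> \<alpha> by (intro mult_left_mono) auto
  also have "\<dots> = 6 * (\<phi>\<^sup>2 / \<xi>)"
    by (simp add: power2_eq_square)
  finally have u2: "\<phi> * \<bar>\<alpha>\<bar> \<le> 6 * G"
    using G2 by simp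
  have inv: "1 / \<mu> \<le> 2 * \<phi> / \<xi>"
    using \<mu> \<xi> by (simp add: field_simps)
  have "\<mu> * P\<^sup>2 / L = (\<mu> * P)\<^sup>2 * (1 / \<mu>) / L"
    using \<mu> by (simp add: power2_eq_square)
  also have "\<dots> \<le> (\<phi>\<^sup>2 * (2 * \<phi> / \<xi>)) / (\<xi> / 2)"
  proof (rule frac_le)
    show "(\<mu> * P)\<^sup>2 * (1 / \<mu>) \<le> \<phi>\<^sup>2 * (2 * \<phi> / \<xi>)"
      using \<mu> P inv by (intro mult_mono power_mono) auto
  qed (use \<phi> \<xi> L in auto)
  also have "\<dots> = 4 * (\<phi> ^ 3 / \<xi>\<^sup>2)"
    by (simp add: power2_eq_square power3_eq_cube)
  finally have l1: "\<mu> * P\<^sup>2 / L \<le> 4 * G"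
    using G1 by simp
  have "- d * ((1 - \<mu>) / \<mu>) \<le> \<phi> * (1 / \<mu>)"
    using d \<mu> \<phi> by (intro mult_mono divide_right_mono) auto
  also have "\<dots> \<le> \<phi> * (2 * \<phi> / \<xi>)"
    using inv \<phi> by (intro mult_left_mono) auto
  also have "\<dots> = 2 * (\<phi>\<^sup>2 / \<xi>)"
    by (simp add: power2_eq_square)
  finally have l2: "- d * ((1 - \<mu>) / \<mu>) \<le> 2 * G"
    using G2 by simp
  show ?thesis
    using u u1 u2 l1 l2 unfolding G_def \<xi>'_def by linarith
qed

section \<open>The running time estimate\<close>

text \<open>For \<open>\<xi> \<le> 1/4\<close> one has \<open>ln (1 / \<xi>) \<ge> 4/3\<close>, which keeps both logarithmic factors of the target away
  from \<open>0\<close>, so that additive constants can be absorbed. The number of iterations is at most a multiple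
  of \<open>ln (1 / \<xi>)\<close>, since \<open>ln \<phi>\<close> is. Inside the logarithm this replaces the failure probability
  \<open>\<delta> / (2 * T)\<close> of a single call by a multiple of \<open>\<delta> / ln (1 / \<xi>)\<close>.\<close>
lemma runtime_bound:
  fixes \<xi> \<phi> c \<delta> \<kappa> :: real and n N w :: nat
  assumes \<xi>: "0 < \<xi>" "\<xi> \<le> 1/4" and \<phi>: "1 \<le> \<phi>" and c: "0 < c" "ln \<phi> \<le> c * ln (1 / \<xi>)"
    and \<delta>: "0 < \<delta>" "\<delta> < 1" and n: "0 < n" and T: "0 < num_iter \<xi> \<phi>" and \<kappa>: "0 \<le> \<kappa>"
  defines "C \<equiv> 2 * c + 7"
  shows "(real (num_iter \<xi> \<phi>) + 1) *
      (\<kappa> * (real N * sqrt \<phi> / sqrt (\<xi> / 4) * ln (real n / (\<delta> / 2 / real (num_iter \<xi> \<phi>)))) + real w * real N)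
    \<le> C * (2 * \<kappa> * (ln (2 * C) / ln (4/3) + 1) + real w / ln (4/3)) *
      (real N * sqrt \<phi> / sqrt \<xi> * ln (real n / \<delta> * ln (1 / \<xi>)) * ln (1 / \<xi>))"
proof -
  define t where "t = real (num_iter \<xi> \<phi>)"
  define L where "L = ln (1 / \<xi>)"
  define \<Lambda> where "\<Lambda> = ln (real n / \<delta> * L)"
  define X where "X = real N * sqrt \<phi> / sqrt \<xi>"
  have "4/3 \<le> 2 * ln (2 :: real)"
    using ln2_ge_two_thirds by simp
  also have "\<dots> = ln (4 :: real)"
    using ln_realpow[of "2 :: real" 2] by simp
  also have "\<dots> \<le> L"
    unfolding L_def using \<xi> by (subst ln_le_cancel_iff) (auto simp: field_simps)
  finally have L: "4/3 \<le> L" .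
  have ln43: "0 < ln (4/3 :: real)"
    by simp
  have t0: "1 \<le> t"
    using T by (simp add: t_def)
  have t1: "t + 1 \<le> C * L"
  proof -
    have "log 2 (8 * \<phi> / \<xi>) = 3 + (ln \<phi> + L) / ln 2"
    proof -
      have "ln (8 * \<phi> / \<xi>) = ln (2 ^ 3) + ln \<phi> + L"
        using \<xi> \<phi> by (simp add: L_def ln_mult ln_div)
      also have "\<dots> = 3 * ln 2 + (ln \<phi> + L)"
        by (subst ln_realpow) auto
      finally show ?thesis
        by (simp add: log_def add_divide_distrib)
    qed
    moreover have "(ln \<phi> + L) / ln 2 \<le> 2 * (ln \<phi> + L)"
    proof -
      have "0 \<le> ln \<phi> + L" using L \<phi> by simp
      then have "(ln \<phi> + L) * 1 \<le> (ln \<phi> + L) * (2 * ln 2)"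
        using ln2_ge_two_thirds by (intro mult_left_mono) auto
      then show ?thesis by (simp add: field_simps)
    qed
    moreover have "t \<le> log 2 (8 * \<phi> / \<xi>) + 1"
    proof -
      have "0 < \<lceil>log 2 (8 * \<phi> / \<xi>)\<rceil>"
        using T by (simp add: num_iter_def)
      then have "t = of_int \<lceil>log 2 (8 * \<phi> / \<xi>)\<rceil>"
        by (simp add: t_def num_iter_def)
      then show ?thesis
        by linarith
    qed
    moreover have "ln \<phi> \<le> c * L"
      using c(2) by (simp only: L_def)
    ultimately have "t + 1 \<le> 5 + 2 * (c * L + L)"
      by simp
    also have "\<dots> \<le> C * L"
      using L by (simp add: C_def algebra_simps)
    finally show ?thesis .
  qed
  have C: "1 \<le> C"
    using c by (simp add: C_def)
  have nd: "1 \<le> real n / \<delta>"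
    using n \<delta> by (simp add: field_simps)
  have \<Lambda>: "ln (4/3) \<le> \<Lambda>"
  proof -
    have "1 * (4/3) \<le> real n / \<delta> * L"
      using nd L by (intro mult_mono) auto
    then show ?thesis
      unfolding \<Lambda>_def by (intro ln_mono) auto
  qed
  have \<Lambda>0: "0 < \<Lambda>"
    using \<Lambda> ln43 by linarith
  have one: "1 \<le> \<Lambda> / ln (4/3)"
    using \<Lambda> ln43 by simp
  have lnT: "ln (real n / (\<delta> / 2 / t)) \<le> (ln (2 * C) / ln (4/3) + 1) * \<Lambda>"
  proof -
    have "real n / (\<delta> / 2 / t) = 2 * t * (real n / \<delta>)"
      by simp
    also have "\<dots> \<le> 2 * (C * L) * (real n / \<delta>)"
      using t1 nd by (intro mult_right_mono mult_left_mono) auto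
    finally have "ln (real n / (\<delta> / 2 / t)) \<le> ln (2 * C * (real n / \<delta> * L))"
      using t0 n \<delta> by (intro ln_mono) (auto simp: algebra_simps)
    also have "\<dots> = ln (2 * C) + \<Lambda>"
      unfolding \<Lambda>_def using C L n \<delta> by (subst ln_mult) auto
    also have "\<dots> \<le> ln (2 * C) * (\<Lambda> / ln (4/3)) + \<Lambda>"
      using one C mult_left_mono[OF one, of "ln (2 * C)"] by simp
    finally show ?thesis by (simp add: algebra_simps)
  qed
  have X: "real N \<le> X"
  proof -
    have "sqrt \<xi> \<le> sqrt \<phi>" using \<xi> \<phi> by simp
    then have "1 \<le> sqrt \<phi> / sqrt \<xi>" using \<xi> by simp
    then have "real N * 1 \<le> real N * (sqrt \<phi> / sqrt \<xi>)"
      by (intro mult_left_mono) auto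
    then show ?thesis by (simp add: X_def)
  qed
  have X2: "real N * sqrt \<phi> / sqrt (\<xi> / 4) = 2 * X"
    by (simp add: X_def real_sqrt_divide)
  have "\<kappa> * (2 * X * ln (real n / (\<delta> / 2 / t))) + real w * real N
      \<le> \<kappa> * (2 * X * ((ln (2 * C) / ln (4/3) + 1) * \<Lambda>)) + real w * (X * (\<Lambda> / ln (4/3)))"
  proof (intro add_mono mult_left_mono lnT \<kappa>)
    have "real N * 1 \<le> X * (\<Lambda> / ln (4/3))"
      using X one by (intro mult_mono) auto
    then show "real N \<le> X * (\<Lambda> / ln (4/3))" by simp
  qed (use X in auto)
  also have "\<dots> = (2 * \<kappa> * (ln (2 * C) / ln (4/3) + 1) + real w / ln (4/3)) * (X * \<Lambda>)"
    by (simp add: algebra_simps)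
  finally have step: "\<kappa> * (2 * X * ln (real n / (\<delta> / 2 / t))) + real w * real N \<le> \<dots>" .
  have K0: "0 \<le> 2 * \<kappa> * (ln (2 * C) / ln (4/3) + 1) + real w / ln (4/3)"
    using \<kappa> C ln43 by (intro add_nonneg_nonneg mult_nonneg_nonneg divide_nonneg_nonneg) auto
  have "(t + 1) * (\<kappa> * (2 * X * ln (real n / (\<delta> / 2 / t))) + real w * real N)
     \<le> (t + 1) * ((2 * \<kappa> * (ln (2 * C) / ln (4/3) + 1) + real w / ln (4/3)) * (X * \<Lambda>))"
    using step t0 by (intro mult_left_mono) auto
  also have "\<dots> \<le> (C * L) * ((2 * \<kappa> * (ln (2 * C) / ln (4/3) + 1) + real w / ln (4/3)) * (X * \<Lambda>))"
    using t1 K0 X \<Lambda>0 by (intro mult_right_mono mult_nonneg_nonneg) auto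
  also have "\<dots> = C * (2 * \<kappa> * (ln (2 * C) / ln (4/3) + 1) + real w / ln (4/3)) * (X * \<Lambda> * L)"
    by (simp add: ac_simps)
  finally show ?thesis
    by (simp only: X2 X_def L_def \<Lambda>_def t_def)
qed

section \<open>Correctness and running time of the algorithm\<close>

lemma instance_props:
  fixes a b :: "real vec" and d :: real
  assumes data: "gtrs_data n A B a b" and sa: "standing_assumption n A B \<rho>\<^sub>A \<rho>\<^sub>B \<xi>"
  defines "\<phi> \<equiv> phi \<rho>\<^sub>A \<rho>\<^sub>B a b d"
  shows "op_norm A + op_norm B \<le> \<phi>" "op_norm A \<le> \<phi>" "op_norm B \<le> \<phi>"
    and "vnorm a + vnorm b \<le> \<phi>" "vnorm a \<le> \<phi>" "vnorm b \<le> \<phi>" "\<bar>d\<bar> \<le> \<phi>" "1 \<le> \<phi>" "\<xi> \<le> \<phi>"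
    and "0 < num_iter \<xi> \<phi>" "8 * \<phi> \<le> 2 ^ num_iter \<xi> \<phi> * \<xi>"
proof -
  have AB: "sym_mat n A" "sym_mat n B" "A \<in> carrier_mat n n" "B \<in> carrier_mat n n" and n: "0 < n"
    using data by (auto simp: gtrs_data_def sym_mat_def)
  have \<rho>: "0 \<le> op_norm A" "op_norm A \<le> \<rho>\<^sub>A" "0 \<le> op_norm B" "op_norm B \<le> \<rho>\<^sub>B"
    using sa op_norm_nonneg[OF _ n] AB by (auto simp: standing_assumption_def)
  have xi: "0 < \<xi>" "lambda_min B \<le> - \<xi>"
    using sa by (auto simp: standing_assumption_def)
  have nonneg: "0 \<le> vnorm a" "0 \<le> vnorm b"
    by auto
  show props: "op_norm A + op_norm B \<le> \<phi>" "op_norm A \<le> \<phi>" "op_norm B \<le> \<phi>"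
     "vnorm a + vnorm b \<le> \<phi>" "vnorm a \<le> \<phi>" "vnorm b \<le> \<phi>" "\<bar>d\<bar> \<le> \<phi>" "1 \<le> \<phi>"
    using \<rho> nonneg unfolding \<phi>_def phi_def by linarith+
  obtain v where v: "v \<in> carrier_vec n" "vnorm v = 1" "v \<bullet> (B *\<^sub>v v) = lambda_min B"
    using lambda_min_rayleigh_attained[OF AB(2) n] by metis
  show \<xi>: "\<xi> \<le> \<phi>"
    using quad_form_le_op_norm[OF AB(4) v(1)] v(2,3) xi props(3) by simp
  have "1 < 8 * \<phi> / \<xi>"
    using \<xi> xi(1) by (simp add: field_simps)
  then have "0 < log 2 (8 * \<phi> / \<xi>)"
    by simp
  then show "0 < num_iter \<xi> \<phi>"
    by (simp add: num_iter_def)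
  have "8 * \<phi> / \<xi> = 2 powr log 2 (8 * \<phi> / \<xi>)"
    using \<open>1 < 8 * \<phi> / \<xi>\<close> by simp
  also have "\<dots> \<le> 2 powr real (num_iter \<xi> \<phi>)"
    unfolding num_iter_def by (intro powr_mono real_nat_ceiling_ge) auto
  also have "\<dots> = 2 ^ num_iter \<xi> \<phi>"
    by (simp add: powr_realpow)
  finally show "8 * \<phi> \<le> 2 ^ num_iter \<xi> \<phi> * \<xi>"
    using xi(1) by (simp add: field_simps)
qed

lemma psd_shift_rayleigh:
  assumes "P \<in> carrier_mat n n" "psd n (P - \<xi> \<cdot>\<^sub>m 1\<^sub>m n)" "x \<in> carrier_vec n" "vnorm x = 1"
  shows "\<xi> \<le> x \<bullet> (P *\<^sub>v x)"
proof -
  have "(P - \<xi> \<cdot>\<^sub>m 1\<^sub>m n) *\<^sub>v x = P *\<^sub>v x - \<xi> \<cdot>\<^sub>v x"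
    using assms by (simp add: minus_mult_distrib_mat_vec[of _ n n] smult_mult_mat_vec[of _ n n])
  then have "0 \<le> x \<bullet> (P *\<^sub>v x - \<xi> \<cdot>\<^sub>v x)"
    using assms(2,3) by (auto simp: psd_def)
  also have "\<dots> = x \<bullet> (P *\<^sub>v x) - \<xi>"
    using assms by (simp add: scalar_prod_minus_distrib[of _ n] scalar_self_eq_vnorm_sq)
  finally show ?thesis by simp
qed

lemma pencil_search_instance:
  fixes a b :: "real vec" and d :: real
  assumes "approx_min_ev R orc \<kappa>" "gtrs_data n A B a b" "standing_assumption n A B \<rho>\<^sub>A \<rho>\<^sub>B \<xi>" "0 < \<delta>"
  defines "\<phi> \<equiv> phi \<rho>\<^sub>A \<rho>\<^sub>B a b d"
  shows "pencil_search R orc \<kappa> n A B \<xi> \<phi> (\<delta> / 2 / real (num_iter \<xi> \<phi>))"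
  using assms instance_props[OF assms(2,3), of d]
  by unfold_locales (auto simp: gtrs_data_def standing_assumption_def)

text \<open>The good event is that all calls of the bisection and the final call for \<open>B\<close> succeed. The final
  call uses a fixed matrix and its own seed, so the plain union bound suffices to combine the two. On
  this event the pencil at the returned \<open>\<mu>\<close> is at least \<open>\<xi> / 2\<close> in every unit direction, while \<open>B\<close> is negative in some
  direction; comparing the two there bounds \<open>\<mu>\<close> away from \<open>0\<close>.\<close>
lemma bounds_correct:
  fixes a b :: "real vec" and d :: real
  assumes solver: "approx_min_ev R orc \<kappa>" and rt: "root_finder rt"
    and data: "gtrs_data n A B a b" and sa: "standing_assumption n A B \<rho>\<^sub>A \<rho>\<^sub>B \<xi>"
    and \<delta>: "0 < \<delta>"
  defines "\<phi> \<equiv> phi \<rho>\<^sub>A \<rho>\<^sub>B a b d" and "S \<equiv> PiM UNIV (\<lambda>i :: nat. R)"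
  shows "holds_with_prob S (1 - \<delta>) (\<lambda>\<omega>. \<exists>\<mu>0 lam l u t.
      bounds orc rt w A B \<xi> a b d \<phi> \<delta> \<omega> = (Some (\<mu>0, lam, l, u), t) \<and>
      ereal l \<le> gtrs_val n A B a b d \<and> gtrs_val n A B a b d \<le> ereal u \<and>
      u - l \<le> 54 * (\<phi> ^ 3 / (min \<xi> 1)\<^sup>2))"
proof -
  define T where "T = num_iter \<xi> \<phi>"
  define \<theta> where "\<theta> = \<delta> / 2 / real T"
  note props = instance_props[OF data sa, of d, folded \<phi>_def, folded T_def]
  interpret pencil_search R orc \<kappa> n A B \<xi> \<phi> \<theta>
    unfolding \<theta>_def T_def \<phi>_def by (rule pencil_search_instance[OF solver data sa \<delta>])
  interpret R: prob_space R by (rule prob_space_R)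
  interpret S: prob_space S
    unfolding S_def by (rule prob_space_PiM) (rule prob_space_R)
  have a: "a \<in> carrier_vec n" and b: "b \<in> carrier_vec n"
    using data by (auto simp: gtrs_data_def)
  have lamB: "lambda_min B \<le> - \<xi>"
    using sa by (auto simp: standing_assumption_def)
  obtain \<mu>s where \<mu>s: "0 < \<mu>s" "\<mu>s \<le> 1" "psd n (pencil A B \<mu>s - \<xi> \<cdot>\<^sub>m 1\<^sub>m n)"
    using sa by (auto simp: standing_assumption_def)
  have pencil_carrier: "pencil A B \<mu> \<in> carrier_mat n n" for \<mu>
    using A_carrier B_carrier by (simp add: pencil_def)
  obtain EB where EB: "EB \<in> sets R" "1 - \<delta> / 2 \<le> measure R EB"
    "\<And>s lam x t. s \<in> EB \<Longrightarrow> orc s B \<phi> (\<xi> / 2) (\<delta> / 2) = (lam, x, t) \<Longrightarrow> lam \<le> lambda_min B + \<xi> / 2"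
    using solver_good_seeds[OF symB props(3), of "\<xi> / 2" "\<delta> / 2"] xi_pos \<delta> by auto
  define F where "F = {\<omega> \<in> space S. search_success T (Some (0, 1)) \<omega>}"
  define G where "G = {\<omega> \<in> space S. \<omega> T \<in> EB}"
  have F: "F \<in> sets S" "measure S (space S - F) \<le> \<delta> / 2"
  proof -
    show "F \<in> sets S"
      using search_success_prob(1)[of T] by (simp add: F_def S_def)
    have "space S - F = {\<omega> \<in> space S. \<not> search_success T (Some (0, 1)) \<omega>}"
      by (auto simp: F_def)
    then show "measure S (space S - F) \<le> \<delta> / 2"
      using search_success_prob(2)[of T] props(10) by (simp add: S_def \<theta>_def)
  qed
  have G: "G \<in> sets S" "measure S (space S - G) \<le> \<delta> / 2"
  proof -
    have comp: "(\<lambda>\<omega>. \<omega> T) \<in> S \<rightarrow>\<^sub>M R"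
      by (simp add: S_def)
    have G_eq: "G = (\<lambda>\<omega>. \<omega> T) -` EB \<inter> space S"
      by (auto simp: G_def)
    show G: "G \<in> sets S"
      unfolding G_eq using comp EB(1) by (rule measurable_sets)
    have "distr S R (\<lambda>\<omega>. \<omega> T) = R"
      unfolding S_def by (rule distr_PiM_component) (auto intro: prob_space_R)
    then have "measure S G = measure R EB"
      unfolding G_eq using measure_distr[OF comp EB(1)] by simp
    then show "measure S (space S - G) \<le> \<delta> / 2"
      using EB(2) S.prob_compl[OF G] by simp
  qed
  have "measure S (space S - F \<inter> G) \<le> measure S ((space S - F) \<union> (space S - G))"
    using F G by (intro S.finite_measure_mono) auto
  also have "\<dots> \<le> measure S (space S - F) + measure S (space S - G)"
    using F G by (intro measure_subadditive) auto
  also have "\<dots> \<le> \<delta>"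
    using F G by simp
  finally have FG: "1 - \<delta> \<le> measure S (F \<inter> G)"
    using S.prob_compl[of "F \<inter> G"] F G by simp
  show ?thesis
    unfolding holds_with_prob_def
  proof (rule bexI[of _ "F \<inter> G"], intro conjI ballI)
    show "F \<inter> G \<in> sets S"
      using F G by blast
    show "1 - \<delta> \<le> measure S (F \<inter> G)"
      by (rule FG)
    fix \<omega> assume "\<omega> \<in> F \<inter> G"
    then have succ: "search_success T (Some (0, 1)) \<omega>" and wT: "\<omega> T \<in> EB" and \<omega>: "\<omega> \<in> UNIV \<rightarrow> space R"
      by (auto simp: F_def G_def S_def space_PiM)
    obtain \<mu> lam x t1 where loop: "psd_loop orc w A B \<xi> \<phi> \<theta> \<omega> T 0 0 1 = (Some (\<mu>, lam, x), t1)"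
      and \<mu>: "0 < \<mu>" "\<mu> \<le> 1" and lam: "3 * \<xi> / 4 \<le> lam" "lam \<le> lambda_min (pencil A B \<mu>) + \<xi> / 4"
      using psd_loop_result[of \<mu>s 0 1 \<omega> T w 0] \<mu>s psd_shift_rayleigh[OF pencil_carrier \<mu>s(3)]
        \<omega> props(10,11) succ by auto
    obtain ev y t2 where y_call: "orc (\<omega> T) B \<phi> (\<xi> / 2) (\<delta> / 2) = (ev, y, t2)"
      by (metis prod.collapse)
    have y: "y \<in> carrier_vec n" "vnorm y = 1" "ev = y \<bullet> (B *\<^sub>v y)"
      using solver_point[OF symB props(3) _ _ _ y_call] xi_pos \<delta> \<omega> by auto
    have ev: "ev \<le> - (\<xi> / 2)"
      using EB(3)[OF wT y_call] lamB by simp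
    define L where "L = lam - \<xi> / 4"
    define \<nu> where "\<nu> = (1 - \<mu>) / \<mu>"
    define l where "l = d * \<nu> - \<mu> * (vnorm (a + \<nu> \<cdot>\<^sub>v b))\<^sup>2 / L"
    define \<alpha> where "\<alpha> = rt ev (b \<bullet> y) d"
    define u where "u = obj_f A a (\<alpha> \<cdot>\<^sub>v y)"
    have run: "bounds orc rt w A B \<xi> a b d \<phi> \<delta> \<omega> =
        (Some (\<mu>, lam, l, u), t1 + t2 + w * (nnz A + nnz B))"
      using loop y_call
      by (simp add: bounds_def psd_pencil_def Let_def l_def u_def \<alpha>_def \<nu>_def L_def
          \<theta>_def flip: T_def)
    have L: "\<xi> / 2 \<le> L"
      using lam by (simp add: L_def)
    have ray: "L * (vnorm z)\<^sup>2 \<le> z \<bullet> (pencil A B \<mu> *\<^sub>v z)" if "z \<in> carrier_vec n" for z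
    proof -
      have "L * (vnorm z)\<^sup>2 \<le> lambda_min (pencil A B \<mu>) * (vnorm z)\<^sup>2"
        using lam by (intro mult_right_mono) (auto simp: L_def)
      also have "\<dots> \<le> z \<bullet> (pencil A B \<mu> *\<^sub>v z)"
        using sym_mat_pencil[OF symA symB] n_pos that by (rule lambda_min_le_rayleigh)
      finally show ?thesis .
    qed
    have lower: "ereal l \<le> gtrs_val n A B a b d"
      unfolding gtrs_val_def
    proof (rule INF_greatest)
      fix z assume z: "z \<in> {z \<in> carrier_vec n. con_h B b d z \<le> 0}"
      then show "ereal l \<le> ereal (obj_f A a z)"
        using gtrs_lower_bound[OF A_carrier B_carrier a b _ _ \<mu>, of z d L] ray L xi_pos
        by (simp add: l_def \<nu>_def)
    qed
    have upper: "gtrs_val n A B a b d \<le> ereal u"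
      unfolding gtrs_val_def u_def
    proof (rule INF_lower)
      have "con_h B b d (\<alpha> \<cdot>\<^sub>v y) \<le> 0"
        using root_finder_feasible[OF rt, of ev "b \<bullet> y" d] ev xi_pos
        by (simp add: con_h_smult[OF B_carrier b y(1)] \<alpha>_def flip: y(3))
      then show "\<alpha> \<cdot>\<^sub>v y \<in> {z \<in> carrier_vec n. con_h B b d z \<le> 0}"
        using y by simp
    qed
    have \<mu>_lower: "\<xi> / 2 \<le> \<mu> * \<phi>"
    proof -
      obtain v where v: "v \<in> carrier_vec n" "vnorm v = 1" "v \<bullet> (B *\<^sub>v v) = lambda_min B"
        using lambda_min_rayleigh_attained[OF symB n_pos] by metis
      have "\<xi> / 2 \<le> v \<bullet> (pencil A B \<mu> *\<^sub>v v)"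
        using ray[OF v(1)] v(2) L by simp
      also have "\<dots> = \<mu> * (v \<bullet> (A *\<^sub>v v)) + (1 - \<mu>) * lambda_min B"
        using quad_form_pencil[OF A_carrier B_carrier v(1)] v(3) by simp
      also have "\<dots> \<le> \<mu> * \<phi> + 0"
        using quad_form_le_op_norm[OF A_carrier v(1)] v(2) props(2) \<mu> lamB xi_pos
        by (intro add_mono mult_left_mono mult_nonneg_nonpos) auto
      finally show ?thesis by simp
    qed
    have \<alpha>_le: "\<bar>\<alpha>\<bar> \<le> 6 * \<phi> / \<xi>"
      unfolding \<alpha>_def
    proof (rule root_finder_abs_le[OF rt xi_pos ev _ props(7,9)])
      show "\<bar>b \<bullet> y\<bar> \<le> \<phi>"
        using scalar_prod_le_vnorm[OF b y(1)] y(2) props(6) by simp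
    qed
    have u_le: "u \<le> \<phi> * \<alpha>\<^sup>2 + 2 * (\<phi> * \<bar>\<alpha>\<bar>)"
    proof -
      have c: "\<alpha> \<cdot>\<^sub>v y \<in> carrier_vec n" and nrm: "vnorm (\<alpha> \<cdot>\<^sub>v y) = \<bar>\<alpha>\<bar>"
        using y by (auto simp: vnorm_smult)
      have "(\<alpha> \<cdot>\<^sub>v y) \<bullet> (A *\<^sub>v (\<alpha> \<cdot>\<^sub>v y)) \<le> op_norm A * \<alpha>\<^sup>2"
        using quad_form_le_op_norm[OF A_carrier c] nrm by (simp add: abs_le_iff)
      also have "\<dots> \<le> \<phi> * \<alpha>\<^sup>2"
        using props(2) by (intro mult_right_mono) auto
      moreover have "a \<bullet> (\<alpha> \<cdot>\<^sub>v y) \<le> vnorm a * \<bar>\<alpha>\<bar>"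
        using scalar_prod_le_vnorm[OF a c] nrm by (simp add: abs_le_iff)
      moreover have "vnorm a * \<bar>\<alpha>\<bar> \<le> \<phi> * \<bar>\<alpha>\<bar>"
        using props(5) by (intro mult_right_mono) auto
      ultimately show ?thesis
        unfolding u_def obj_f_def by linarith
    qed
    have P_le: "\<mu> * vnorm (a + \<nu> \<cdot>\<^sub>v b) \<le> \<phi>"
    proof -
      have "vnorm (a + \<nu> \<cdot>\<^sub>v b) \<le> vnorm a + \<nu> * vnorm b"
        using vnorm_triangle[OF a, of "\<nu> \<cdot>\<^sub>v b"] b \<mu> by (simp add: vnorm_smult \<nu>_def)
      then have "\<mu> * vnorm (a + \<nu> \<cdot>\<^sub>v b) \<le> \<mu> * (vnorm a + \<nu> * vnorm b)"
        using \<mu> by (intro mult_left_mono) auto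
      also have "\<dots> = \<mu> * vnorm a + (1 - \<mu>) * vnorm b"
      proof -
        have "\<mu> * \<nu> = 1 - \<mu>"
          using \<mu> by (simp add: \<nu>_def)
        then show ?thesis
          by (simp add: distrib_left flip: mult.assoc)
      qed
      also have "\<dots> \<le> 1 * vnorm a + 1 * vnorm b"
        using \<mu> by (intro add_mono mult_right_mono) auto
      finally show ?thesis
        using props(4) by simp
    qed
    have "u - l \<le> 54 * (\<phi> ^ 3 / (min \<xi> 1)\<^sup>2)"
      unfolding l_def \<nu>_def
      by (rule gap_bound[OF props(8) xi_pos props(9) \<alpha>_le u_le \<mu>_lower \<mu> L vnorm_nonneg
            P_le[unfolded \<nu>_def] props(7)])
    with run lower upper show "\<exists>\<mu>0 lam l u t.
      bounds orc rt w A B \<xi> a b d \<phi> \<delta> \<omega> = (Some (\<mu>0, lam, l, u), t) \<and>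
      ereal l \<le> gtrs_val n A B a b d \<and> gtrs_val n A B a b d \<le> ereal u \<and>
      u - l \<le> 54 * (\<phi> ^ 3 / (min \<xi> 1)\<^sup>2)"
      by blast
  qed
qed

text \<open>The running time bound of the solver holds for every seed, so this bound does too: every call is
  at most as expensive as one in the bisection, because the final call has the larger tolerance
  and a failure probability that is at least as large.\<close>
lemma bounds_time:
  fixes a b :: "real vec" and d :: real
  assumes solver: "approx_min_ev R orc \<kappa>"
    and data: "gtrs_data n A B a b" and sa: "standing_assumption n A B \<rho>\<^sub>A \<rho>\<^sub>B \<xi>"
    and \<delta>: "0 < \<delta>" "\<delta> < 1" and \<omega>: "\<omega> \<in> UNIV \<rightarrow> space R"
  defines "\<phi> \<equiv> phi \<rho>\<^sub>A \<rho>\<^sub>B a b d"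
  defines "T \<equiv> num_iter \<xi> \<phi>" and "N \<equiv> nnz A + nnz B"
  shows "real (snd (bounds orc rt w A B \<xi> a b d \<phi> \<delta> \<omega>)) \<le> (real T + 1) *
    (\<bar>\<kappa>\<bar> * (real N * sqrt \<phi> / sqrt (\<xi> / 4) * ln (real n / (\<delta> / 2 / real T))) + real w * real N)"
proof -
  define \<theta> where "\<theta> = \<delta> / 2 / real T"
  define \<tau> where "\<tau> = \<bar>\<kappa>\<bar> * (real N * sqrt \<phi> / sqrt (\<xi> / 4) * ln (real n / \<theta>))"
  note props = instance_props[OF data sa, of d, folded \<phi>_def, folded T_def]
  interpret pencil_search R orc \<kappa> n A B \<xi> \<phi> \<theta>
    unfolding \<theta>_def T_def \<phi>_def by (rule pencil_search_instance[OF solver data sa \<delta>(1)])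
  have N: "n \<le> N"
    using data by (simp add: gtrs_data_def N_def)
  have T: "1 \<le> real T"
    using props(10) by simp
  have \<theta>: "0 < \<theta>" "\<theta> \<le> \<delta> / 2"
    using \<delta> T by (auto simp: \<theta>_def field_simps)
  have n\<theta>: "1 \<le> real n / (\<delta> / 2)" "real n / (\<delta> / 2) \<le> real n / \<theta>"
    using \<theta> \<delta> n_pos by (auto simp: field_simps intro!: divide_left_mono)
  have ln_n: "0 \<le> ln (real n / \<theta>)" "0 \<le> ln (real n / (\<delta> / 2))" "ln (real n / (\<delta> / 2)) \<le> ln (real n / \<theta>)"
    using n\<theta> by (auto intro!: ln_mono)
  have \<tau>0: "0 \<le> \<tau>"
    unfolding \<tau>_def using ln_n props(8) xi_pos by (intro mult_nonneg_nonneg divide_nonneg_nonneg) auto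
  have t1: "real (snd (psd_loop orc w A B \<xi> \<phi> \<theta> \<omega> T 0 0 1)) \<le> real T * (\<tau> + real w * real N)"
    unfolding N_def
  proof (rule psd_loop_time[OF _ \<tau>0 \<omega>])
    fix \<mu> s lam x t
    assume \<mu>: "0 \<le> \<mu>" "\<mu> \<le> 1" and s: "s \<in> space R"
      and call: "orc s (pencil A B \<mu>) \<phi> (\<xi> / 4) \<theta> = (lam, x, t)"
    have "real t \<le> \<kappa> * (real N * sqrt \<phi> / sqrt (\<xi> / 4) * ln (real n / \<theta>))"
      using solver_time[OF pencil_props[OF \<mu>] _ _ s call _ _ N] nnz_pencil_le[OF A_carrier B_carrier]
        xi_pos props(9) \<theta> \<delta> by (simp add: N_def)
    also have "\<dots> \<le> \<tau>"
      unfolding \<tau>_def using ln_n props(8) xi_pos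
      by (intro mult_right_mono mult_nonneg_nonneg divide_nonneg_nonneg) auto
    finally show "real t \<le> \<tau>" .
  qed auto
  have t2: "real (snd (snd (orc (\<omega> T) B \<phi> (\<xi> / 2) (\<delta> / 2)))) \<le> \<tau>"
  proof -
    obtain ev y t where call: "orc (\<omega> T) B \<phi> (\<xi> / 2) (\<delta> / 2) = (ev, y, t)"
      by (metis prod.collapse)
    have "real t \<le> \<kappa> * (real N * sqrt \<phi> / sqrt (\<xi> / 2) * ln (real n / (\<delta> / 2)))"
      using solver_time[OF symB props(3) _ _ _ call _ _ N] xi_pos \<delta> \<omega> props(9)
      by (auto simp: N_def)
    also have "\<dots> \<le> \<bar>\<kappa>\<bar> * (real N * sqrt \<phi> / sqrt (\<xi> / 2) * ln (real n / (\<delta> / 2)))"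
      using ln_n props(8) xi_pos
      by (intro mult_right_mono mult_nonneg_nonneg divide_nonneg_nonneg) auto
    also have "\<dots> \<le> \<tau>"
      unfolding \<tau>_def using ln_n props(8) xi_pos
      by (intro mult_left_mono mult_mono frac_le mult_nonneg_nonneg divide_nonneg_nonneg) auto
    finally show ?thesis using call by simp
  qed
  have "snd (bounds orc rt w A B \<xi> a b d \<phi> \<delta> \<omega>) \<le>
      snd (psd_loop orc w A B \<xi> \<phi> \<theta> \<omega> T 0 0 1) + snd (snd (orc (\<omega> T) B \<phi> (\<xi> / 2) (\<delta> / 2))) + w * N"
    by (simp add: bounds_def psd_pencil_def Let_def N_def \<theta>_def T_def[symmetric] split: prod.split option.split)
  then have "real (snd (bounds orc rt w A B \<xi> a b d \<phi> \<delta> \<omega>)) \<le>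
      real (snd (psd_loop orc w A B \<xi> \<phi> \<theta> \<omega> T 0 0 1)) +
      real (snd (snd (orc (\<omega> T) B \<phi> (\<xi> / 2) (\<delta> / 2)))) + real w * real N"
    by (metis of_nat_add of_nat_le_iff of_nat_mult)
  also have "\<dots> \<le> (real T + 1) * (\<tau> + real w * real N)"
    using t1 t2 by (simp add: algebra_simps)
  finally show ?thesis
    by (simp only: \<tau>_def \<theta>_def)
qed

theorem theorem3p2:
  fixes R :: "'r measure" and orc :: "'r ev_solver" and \<kappa> :: real
    and rt :: "real \<Rightarrow> real \<Rightarrow> real \<Rightarrow> real" and w :: nat
  assumes "approx_min_ev R orc \<kappa>" and "root_finder rt"
  shows "\<exists>K\<^sub>1 > 0. \<forall>c > 0. \<exists>K\<^sub>2 > 0.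
    \<forall>(n :: nat) (A :: real mat) (B :: real mat) (a :: real vec) (b :: real vec) (d :: real)
      (\<rho>\<^sub>A :: real) (\<rho>\<^sub>B :: real) (\<xi> :: real) (\<epsilon> :: real) (\<delta> :: real).
      gtrs_data n A B a b \<and> standing_assumption n A B \<rho>\<^sub>A \<rho>\<^sub>B \<xi> \<and> 0 < \<epsilon> \<and> 0 < \<delta> \<and> \<delta> < 1 \<longrightarrow>
      (let \<phi> = phi \<rho>\<^sub>A \<rho>\<^sub>B a b d;
           \<xi>' = min \<xi> 1;
           N = real (nnz A + nnz B);
           P = PiM UNIV (\<lambda>i :: nat. R);
           run = bounds orc rt w A B \<xi> a b d \<phi> \<delta>
       in holds_with_prob P (1 - \<delta>)
            (\<lambda>\<omega>. \<exists>\<mu>0 lam l u t. run \<omega> = (Some (\<mu>0, lam, l, u), t) \<and>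
               ereal l \<le> gtrs_val n A B a b d \<and> gtrs_val n A B a b d \<le> ereal u \<and>
               u - l \<le> K\<^sub>1 * (\<phi> ^ 3 / \<xi>'\<^sup>2)) \<and>
          (\<xi> \<le> 1/4 \<and> ln \<phi> \<le> c * ln (1 / \<xi>) \<longrightarrow>
            (\<forall>\<omega> \<in> space P. real (snd (run \<omega>)) \<le>
               K\<^sub>2 * (N * sqrt \<phi> / sqrt \<xi> * ln (real n / \<delta> * ln (1 / \<xi>)) * ln (1 / \<xi>)))))"
proof (rule exI[of _ "54 :: real"], intro conjI allI impI)
  fix c :: real assume c: "0 < c"
  define C where "C = 2 * c + 7"
  define K where "K = C * (2 * \<bar>\<kappa>\<bar> * (ln (2 * C) / ln (4/3) + 1) + real w / ln (4/3))"
  have "0 \<le> K"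
    using c by (simp add: K_def C_def)
  show "\<exists>K\<^sub>2 > 0. \<forall>(n :: nat) (A :: real mat) (B :: real mat) (a :: real vec) (b :: real vec) (d :: real)
      (\<rho>\<^sub>A :: real) (\<rho>\<^sub>B :: real) (\<xi> :: real) (\<epsilon> :: real) (\<delta> :: real).
      gtrs_data n A B a b \<and> standing_assumption n A B \<rho>\<^sub>A \<rho>\<^sub>B \<xi> \<and> 0 < \<epsilon> \<and> 0 < \<delta> \<and> \<delta> < 1 \<longrightarrow>
      (let \<phi> = phi \<rho>\<^sub>A \<rho>\<^sub>B a b d;
           \<xi>' = min \<xi> 1;
           N = real (nnz A + nnz B);
           P = PiM UNIV (\<lambda>i :: nat. R);
           run = bounds orc rt w A B \<xi> a b d \<phi> \<delta>
       in holds_with_prob P (1 - \<delta>)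
            (\<lambda>\<omega>. \<exists>\<mu>0 lam l u t. run \<omega> = (Some (\<mu>0, lam, l, u), t) \<and>
               ereal l \<le> gtrs_val n A B a b d \<and> gtrs_val n A B a b d \<le> ereal u \<and>
               u - l \<le> 54 * (\<phi> ^ 3 / \<xi>'\<^sup>2)) \<and>
          (\<xi> \<le> 1/4 \<and> ln \<phi> \<le> c * ln (1 / \<xi>) \<longrightarrow>
            (\<forall>\<omega> \<in> space P. real (snd (run \<omega>)) \<le>
               K\<^sub>2 * (N * sqrt \<phi> / sqrt \<xi> * ln (real n / \<delta> * ln (1 / \<xi>)) * ln (1 / \<xi>)))))"
  proof (rule exI[of _ "K + 1"], unfold Let_def, intro conjI allI impI ballI; (elim conjE)?)
    show "0 < K + 1" using \<open>0 \<le> K\<close> by simp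
  next
    fix n A B and a b :: "real vec" and d \<rho>\<^sub>A \<rho>\<^sub>B \<xi> \<delta> :: real
    assume "gtrs_data n A B a b" "standing_assumption n A B \<rho>\<^sub>A \<rho>\<^sub>B \<xi>" "0 < \<delta>"
    then show "holds_with_prob (PiM UNIV (\<lambda>i :: nat. R)) (1 - \<delta>) (\<lambda>\<omega>. \<exists>\<mu>0 lam l u t.
      bounds orc rt w A B \<xi> a b d (phi \<rho>\<^sub>A \<rho>\<^sub>B a b d) \<delta> \<omega> = (Some (\<mu>0, lam, l, u), t) \<and>
      ereal l \<le> gtrs_val n A B a b d \<and> gtrs_val n A B a b d \<le> ereal u \<and>
      u - l \<le> 54 * (phi \<rho>\<^sub>A \<rho>\<^sub>B a b d ^ 3 / (min \<xi> 1)\<^sup>2))"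
      by (rule bounds_correct[OF assms])
  next
    fix n A B and a b :: "real vec" and d \<rho>\<^sub>A \<rho>\<^sub>B \<xi> \<delta> :: real and \<omega>
    assume data: "gtrs_data n A B a b" and sa: "standing_assumption n A B \<rho>\<^sub>A \<rho>\<^sub>B \<xi>"
      and \<delta>: "0 < \<delta>" "\<delta> < 1" and \<omega>: "\<omega> \<in> space (PiM UNIV (\<lambda>i :: nat. R))"
      and \<xi>: "\<xi> \<le> 1/4" "ln (phi \<rho>\<^sub>A \<rho>\<^sub>B a b d) \<le> c * ln (1 / \<xi>)"
    define \<phi> where "\<phi> = phi \<rho>\<^sub>A \<rho>\<^sub>B a b d"
    define N where "N = nnz A + nnz B"
    define X where "X = real N * sqrt \<phi> / sqrt \<xi> * ln (real n / \<delta> * ln (1 / \<xi>)) * ln (1 / \<xi>)"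
    note props = instance_props[OF data sa, of d, folded \<phi>_def]
    have "0 < \<xi>" "0 < n"
      using data sa by (auto simp: standing_assumption_def gtrs_data_def)
    have "real (snd (bounds orc rt w A B \<xi> a b d \<phi> \<delta> \<omega>)) \<le> K * X"
      unfolding K_def X_def C_def N_def \<phi>_def
      using bounds_time[OF assms(1) data sa \<delta>, of \<omega> rt w d]
        runtime_bound[of \<xi> \<phi> c \<delta> n "\<bar>\<kappa>\<bar>" N w] \<omega> \<delta> \<xi> props(8,10) c \<open>0 < \<xi>\<close> \<open>0 < n\<close>
      by (force simp: space_PiM \<phi>_def N_def)
    also have "\<dots> \<le> (K + 1) * X"
    proof -
      have "4 \<le> 1 / \<xi>"
        using \<xi> \<open>0 < \<xi>\<close> by (simp add: field_simps)
      then have "exp 1 \<le> 1 / \<xi>"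
        using exp_le by linarith
      then have L: "1 \<le> ln (1 / \<xi>)"
        using \<open>0 < \<xi>\<close> by (subst ln_ge_iff) auto
      have "1 \<le> real n / \<delta>"
        using \<delta> \<open>0 < n\<close> by (simp add: field_simps)
      then have "1 * 1 \<le> real n / \<delta> * ln (1 / \<xi>)"
        using L by (intro mult_mono) auto
      then have "0 \<le> ln (real n / \<delta> * ln (1 / \<xi>))"
        by simp
      then have "0 \<le> X"
        unfolding X_def using L \<xi>(1) \<open>0 < \<xi>\<close> props(8) by (intro mult_nonneg_nonneg divide_nonneg_nonneg) auto
      then show ?thesis by (simp add: algebra_simps)
    qed
    finally show "real (snd (bounds orc rt w A B \<xi> a b d (phi \<rho>\<^sub>A \<rho>\<^sub>B a b d) \<delta> \<omega>)) \<le>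
      (K + 1) * (real (nnz A + nnz B) * sqrt (phi \<rho>\<^sub>A \<rho>\<^sub>B a b d) / sqrt \<xi> *
        ln (real n / \<delta> * ln (1 / \<xi>)) * ln (1 / \<xi>))"
      by (simp only: X_def N_def \<phi>_def)
  qed
qed simp

end
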